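(* $\mathrm{SSCM}(2,1;5;3,2)=\mathrm{RE}$. That is, a language is recursively enumerable if and only if it is generated by a simple semi-conditional matrix grammar of degree $(2,1)$ with at most $5$ nonterminals, at most $3$ conditional matrices, and all matrices of length at most $2$.
   Context: A semi-conditional matrix (SCM) grammar is a quadruple $G=(V,T,M,S)$ with the following components. - $V$ is a finite alphabet and $T\subsetneq V$ is the set of terminals. - $N=V\setminus T$ is the set of nonterminals and $S\in N$ is the start symbol. - $M$ is a finite set of matrices of the form $r=[(A_1\to x_1),\dots,(A_\ell\to x_\ell),P,F]$, where $\ell\ge 1$, $A_k\in N$, $x_k\in V^*$, and $P,F\in V^+\cup\{\emptyset\}$. Here $\emptyset\notin V$ is a special symbol meaning that the condition is absent, and $|\emptyset|=0$. The number $\ell$ is the length of $r$. A matrix is classified as follows: - unconditional if $P=F=\emptyset$, and conditional otherwise; - simple if at least one of $P,F$ equals $\emptyset$, and non-simple if both $P\neq\emptyset$ and $F\neq\emptyset$. For $x,y\in V^*$ we write $x\Rightarrow_r y$ iff all of the following hold: 1. if $P\neq\emptyset$ then $P$ is a subword (factor) of $x$; 2. if $F\neq\emptyset$ then $F$ is not a subword of $x$; 3. there are words $x=y_0,y_1,\dots,y_\ell=y$ such that $y_k$ is obtained from $y_{k-1}$ by replacing one occurrence of $A_k$ by $x_k$. $\Rightarrow_G$ is the union of the relations $\Rightarrow_r$ over $r\in M$, and $L(G)=\{y\in T^*: S\Rightarrow_G^* y\}$. $G$ has degree $(i,j)$ if every matrix satisfies $|P|\le i$ and $|F|\le j$. $\mathrm{SCM}(i,j;n;m,\ell,s)$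 denotes the family of languages $L(G)$ of SCM grammars $G$ that satisfy all of the following: - $G$ has degree $(i,j)$; - $|N|\le n$; - $G$ has at most $m$ conditional matrices; - every matrix of $G$ has length at most $\ell$; - $G$ has at most $s$ non-simple matrices. A $*$ in a parameter position means that parameter is unbounded. $\mathrm{SSCM}(i,j;n;m,\ell)=\mathrm{SCM}(i,j;n;m,\ell,0)$, i.e., all matrices are simple. $\mathrm{RE}$ is the class of recursively enumerable languages. *)

theory Defs
  imports Main "HOL-Library.Sublist"
begin

datatype 't sym = Tm 't | Nt nat

definition syms :: "nat set \<Rightarrow> 't set \<Rightarrow> 't sym set" where
  "syms N T = Tm ` T \<union> Nt ` N"

record 't psg =
  ps_N :: "nat set"
  ps_T :: "'t set"
  ps_S :: nat
  ps_R :: "('t sym list \<times> 't sym list) set"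

definition psg_wf :: "'t psg \<Rightarrow> bool" where
  "psg_wf G \<longleftrightarrow> finite (ps_N G) \<and> finite (ps_T G) \<and> ps_S G \<in> ps_N G \<and> finite (ps_R G) \<and>
     (\<forall>(u,v) \<in> ps_R G. set u \<subseteq> syms (ps_N G) (ps_T G) \<and> set v \<subseteq> syms (ps_N G) (ps_T G)
        \<and> (\<exists>A \<in> ps_N G. Nt A \<in> set u))"

definition psg_step :: "'t psg \<Rightarrow> 't sym list \<Rightarrow> 't sym list \<Rightarrow> bool" where
  "psg_step G x y \<longleftrightarrow> (\<exists>p q u v. (u,v) \<in> ps_R G \<and> x = p @ u @ q \<and> y = p @ v @ q)"

definition psg_lang :: "'t psg \<Rightarrow> 't list set" where
  "psg_lang G = {w. set w \<subseteq> ps_T G \<and> (psg_step G)\<^sup>*\<^sup>* [Nt (ps_S G)] (map Tm w)}"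

definition RE :: "'t list set set" where
  "RE = {L. \<exists>G. psg_wf G \<and> L = psg_lang G}"

text \<open>A matrix: list of rules (A \<rightarrow> x), permitting condition P, forbidding condition F;
  None encodes the absent condition \<emptyset>.\<close>
record 't matrix =
  mx_rules :: "(nat \<times> 't sym list) list"
  mx_P :: "'t sym list option"
  mx_F :: "'t sym list option"

record 't scmg =
  scm_N :: "nat set"
  scm_T :: "'t set"
  scm_S :: nat
  scm_M :: "'t matrix set"

definition cond_ok :: "nat set \<Rightarrow> 't set \<Rightarrow> 't sym list option \<Rightarrow> bool" where
  "cond_ok N T c \<longleftrightarrow> (case c of None \<Rightarrow> True | Some w \<Rightarrow> w \<noteq> [] \<and> set w \<subseteq> syms N T)"

definition scm_wf :: "'t scmg \<Rightarrow> bool" where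
  "scm_wf G \<longleftrightarrow> finite (scm_N G) \<and> finite (scm_T G) \<and> scm_S G \<in> scm_N G \<and> finite (scm_M G) \<and>
     (\<forall>r \<in> scm_M G. mx_rules r \<noteq> [] \<and>
        (\<forall>(A,x) \<in> set (mx_rules r). A \<in> scm_N G \<and> set x \<subseteq> syms (scm_N G) (scm_T G)) \<and>
        cond_ok (scm_N G) (scm_T G) (mx_P r) \<and> cond_ok (scm_N G) (scm_T G) (mx_F r))"

fun apply_rules :: "(nat \<times> 't sym list) list \<Rightarrow> 't sym list \<Rightarrow> 't sym list \<Rightarrow> bool" where
  "apply_rules [] x y \<longleftrightarrow> x = y"
| "apply_rules ((A,w) # rs) x y \<longleftrightarrow> (\<exists>u v. x = u @ [Nt A] @ v \<and> apply_rules rs (u @ w @ v) y)"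

definition mx_step :: "'t matrix \<Rightarrow> 't sym list \<Rightarrow> 't sym list \<Rightarrow> bool" where
  "mx_step r x y \<longleftrightarrow>
     (case mx_P r of None \<Rightarrow> True | Some P \<Rightarrow> sublist P x) \<and>
     (case mx_F r of None \<Rightarrow> True | Some F \<Rightarrow> \<not> sublist F x) \<and>
     apply_rules (mx_rules r) x y"

definition scm_step :: "'t scmg \<Rightarrow> 't sym list \<Rightarrow> 't sym list \<Rightarrow> bool" where
  "scm_step G x y \<longleftrightarrow> (\<exists>r \<in> scm_M G. mx_step r x y)"

definition scm_lang :: "'t scmg \<Rightarrow> 't list set" where
  "scm_lang G = {w. set w \<subseteq> scm_T G \<and> (scm_step G)\<^sup>*\<^sup>* [Nt (scm_S G)] (map Tm w)}"

definition cond_len :: "'t sym list option \<Rightarrow> nat" where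
  "cond_len c = (case c of None \<Rightarrow> 0 | Some w \<Rightarrow> length w)"

definition conditional :: "'t matrix \<Rightarrow> bool" where
  "conditional r \<longleftrightarrow> \<not> (mx_P r = None \<and> mx_F r = None)"

definition non_simple :: "'t matrix \<Rightarrow> bool" where
  "non_simple r \<longleftrightarrow> mx_P r \<noteq> None \<and> mx_F r \<noteq> None"

definition SCM :: "nat \<Rightarrow> nat \<Rightarrow> nat \<Rightarrow> nat \<Rightarrow> nat \<Rightarrow> nat \<Rightarrow> 't list set set" where
  "SCM i j n m l s = {L. \<exists>G. scm_wf G \<and> L = scm_lang G \<and>
     (\<forall>r \<in> scm_M G. cond_len (mx_P r) \<le> i \<and> cond_len (mx_F r) \<le> j \<and> length (mx_rules r) \<le> l) \<and>
     card (scm_N G) \<le> n \<and>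
     card {r \<in> scm_M G. conditional r} \<le> m \<and>
     card {r \<in> scm_M G. non_simple r} \<le> s}"

definition SSCM :: "nat \<Rightarrow> nat \<Rightarrow> nat \<Rightarrow> nat \<Rightarrow> nat \<Rightarrow> 't list set set" where
  "SSCM i j n m l = SCM i j n m l 0"

end

theory Submission
  imports Defs
begin

text \<open>
  A phrase structure grammar simulates a matrix grammar with a head that walks through the sentential
  form between two end markers: it scans for the forbidden symbol, looks for the permitted word, and
  then performs the rules of the matrix one by one.

  Conversely, a derivation of a phrase structure grammar is run backwards on a queue: the word
  \<open>\<beta> # \<alpha>\<close> stands for the sentential form \<open>\<alpha>\<beta>\<close>, and pulling \<open>r c\<close> from the front while pushing \<open>l c\<close>
  at the back undoes the rule \<open>l \<rightarrow> r\<close>. The history of the queue is a solution of a Post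
  correspondence problem: a single nonterminal \<open>S\<close> writes all pushed letters to its left and all pulled
  letters, in reverse order, to its right, and the two words have to cancel. A letter with number \<open>k\<close> is
  written \<open>A^(k+1) C\<close> on the left and \<open>C B^(k+1)\<close> on the right, so that deleting adjacent \<open>AB\<close> and \<open>CC\<close>
  suffices, and such pairs are adjacent only at the border of the two words. One deletion marks both
  symbols with \<open>$\<close>, which is allowed only if no \<open>$\<close> is present, and erases the two marks if they form
  the word \<open>$$\<close>; a wrongly chosen pair of marks never becomes adjacent and blocks the derivation.
\<close>

section \<open>Phrase structure grammars simulate matrix grammars\<close>

text \<open>\<open>LM\<close> and \<open>RM\<close> are the end markers. \<open>ChkF r\<close>
  sweeps right past letters that are not forbidden, \<open>ChkP r\<close> sweeps left to the
  permitted word, and \<open>App rs\<close> carries the rules still to be applied;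
  \<open>App []\<close> is idle.\<close>

datatype 't head = Init | LM | RM | App "(nat \<times> 't sym list) list" | ChkF "'t matrix" | ChkP "'t matrix"

text \<open>Taking the suffixes of all rule lists keeps the set of head states finite. The bound on
  forbidding conditions allows them to be checked letter by letter.\<close>

locale scm_simulation =
  fixes G :: "'t scmg" and h :: "'t head \<Rightarrow> nat"
  fixes Rs :: "(nat \<times> 't sym list) list set" and Q :: "'t head set" and \<Sigma> :: "'t sym set"
  defines "Rs \<equiv> insert [] (\<Union>r\<in>scm_M G. set (suffixes (mx_rules r)))"
    and "Q \<equiv> {Init, LM, RM} \<union> App ` Rs \<union> ChkF ` scm_M G \<union> ChkP ` scm_M G"
    and "\<Sigma> \<equiv> syms (scm_N G) (scm_T G)"
  assumes wf: "scm_wf G"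
    and F_len: "\<And>r. r \<in> scm_M G \<Longrightarrow> cond_len (mx_F r) \<le> 1"
    and inj: "inj_on h Q"
    and fresh: "h ` Q \<inter> scm_N G = {}"
begin

section \<open>Rules and well-formedness of the simulating grammar\<close>

abbreviation nt :: "'t head \<Rightarrow> 't sym" where "nt q \<equiv> Nt (h q)"

abbreviation reach :: "'t sym list \<Rightarrow> bool" where
  "reach \<equiv> (scm_step G)\<^sup>*\<^sup>* [Nt (scm_S G)]"

text \<open>A head \<open>App rs\<close> may wander in both directions, since a rule may hit any
  occurrence. A scan \<open>ChkF r\<close> starts at the left marker and ends only at the right one,
  so it has passed every letter. An absent permitting condition is treated as the empty word, which
  occurs everywhere.\<close>

definition sim_rules :: "('t sym list \<times> 't sym list) set" where
  "sim_rules =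
     {([nt Init], [nt LM, nt (App []), Nt (scm_S G), nt RM]),
      ([nt RM], []),
      ([nt LM, nt (App [])], [])}
   \<union> (\<lambda>r. ([nt LM, nt (App [])], [nt LM, nt (ChkF r)])) ` scm_M G
   \<union> (\<lambda>(r, c). ([nt (ChkF r), c], [c, nt (ChkF r)])) ` (SIGMA r:scm_M G. {c \<in> \<Sigma>. mx_F r \<noteq> Some [c]})
   \<union> (\<lambda>r. ([nt (ChkF r), nt RM], [nt (ChkP r), nt RM])) ` scm_M G
   \<union> (\<lambda>(r, c). ([c, nt (ChkP r)], [nt (ChkP r), c])) ` (scm_M G \<times> \<Sigma>)
   \<union> (\<lambda>r. (nt (ChkP r) # (case mx_P r of None \<Rightarrow> [] | Some P \<Rightarrow> P),
            nt (App (mx_rules r)) # (case mx_P r of None \<Rightarrow> [] | Some P \<Rightarrow> P))) ` scm_M G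
   \<union> (\<lambda>(rs, c). ([nt (App rs), c], [c, nt (App rs)])) ` (Rs \<times> \<Sigma>)
   \<union> (\<lambda>(rs, c). ([c, nt (App rs)], [nt (App rs), c])) ` (Rs \<times> \<Sigma>)
   \<union> (\<lambda>rs. ([nt (App rs), Nt (fst (hd rs))], snd (hd rs) @ [nt (App (tl rs))])) ` (Rs - {[]})"

definition sim_psg :: "'t psg" where
  "sim_psg = \<lparr>ps_N = scm_N G \<union> h ` Q, ps_T = scm_T G, ps_S = h Init, ps_R = sim_rules\<rparr>"

lemma finite_Sigma: "finite \<Sigma>"
  using wf by (auto simp: \<Sigma>_def syms_def scm_wf_def)

lemma finite_Rs: "finite Rs"
  using wf by (auto simp: Rs_def scm_wf_def)

lemma finite_Q: "finite Q"
  using wf finite_Rs by (auto simp: Q_def scm_wf_def)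

lemma Nil_in_Rs: "[] \<in> Rs"
  by (simp add: Rs_def)

lemma mx_rules_in_Rs: "r \<in> scm_M G \<Longrightarrow> mx_rules r \<in> Rs"
  by (auto simp: Rs_def)

lemma Rs_ConsD:
  assumes "(A, w) # rs \<in> Rs"
  shows "rs \<in> Rs" "A \<in> scm_N G" "set w \<subseteq> \<Sigma>"
proof -
  obtain r where r: "r \<in> scm_M G" "suffix ((A, w) # rs) (mx_rules r)"
    using assms by (auto simp: Rs_def)
  then show "rs \<in> Rs"
    by (auto simp: Rs_def dest: suffix_ConsD)
  have "(A, w) \<in> set (mx_rules r)"
    using set_mono_suffix[OF r(2)] by auto
  then show "A \<in> scm_N G" "set w \<subseteq> \<Sigma>"
    using wf r(1) unfolding scm_wf_def \<Sigma>_def by fast+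
qed

lemma Sigma_NtI: "A \<in> scm_N G \<Longrightarrow> Nt A \<in> \<Sigma>"
  by (auto simp: \<Sigma>_def syms_def)

lemma start_in_Sigma: "Nt (scm_S G) \<in> \<Sigma>"
  using wf by (auto simp: \<Sigma>_def syms_def scm_wf_def)

lemma P_in_Sigma: "r \<in> scm_M G \<Longrightarrow> mx_P r = Some P \<Longrightarrow> set P \<subseteq> \<Sigma>"
  using wf by (force simp: \<Sigma>_def scm_wf_def cond_ok_def)

lemma nt_notin_Sigma: "q \<in> Q \<Longrightarrow> nt q \<notin> \<Sigma>"
  using fresh by (auto simp: \<Sigma>_def syms_def)

lemma Q_intros:
  "Init \<in> Q" "LM \<in> Q" "RM \<in> Q"
  "rs \<in> Rs \<Longrightarrow> App rs \<in> Q"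
  "r \<in> scm_M G \<Longrightarrow> ChkF r \<in> Q" "r \<in> scm_M G \<Longrightarrow> ChkP r \<in> Q"
  by (auto simp: Q_def)

lemma nt_eqD: "nt q = nt q' \<Longrightarrow> q \<in> Q \<Longrightarrow> q' \<in> Q \<Longrightarrow> q = q'"
  using inj by (auto dest: inj_onD)

lemma mx_F_cases:
  assumes "r \<in> scm_M G"
  obtains "mx_F r = None" | f where "mx_F r = Some [f]"
proof (cases "mx_F r")
  case (Some F)
  then have "F \<noteq> []" "length F \<le> 1"
    using wf assms F_len[OF assms] by (auto simp: scm_wf_def cond_ok_def cond_len_def)
  then have "\<exists>f. F = [f]"
    by (cases F) auto
  then show ?thesis
    using that Some by blast
qed (use that in blast)

lemma sim_psg_wf: "psg_wf sim_psg"
proof -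
  have fin: "finite sim_rules"
    unfolding sim_rules_def
    using wf finite_Rs finite_Sigma by (auto simp: scm_wf_def)
  have sub: "\<Sigma> \<subseteq> syms (scm_N G \<union> h ` Q) (scm_T G)"
    by (auto simp: \<Sigma>_def syms_def)
  have nt: "nt q \<in> syms (scm_N G \<union> h ` Q) (scm_T G)" if "q \<in> Q" for q
    using that by (auto simp: syms_def)
  have *: "set u \<subseteq> syms (scm_N G \<union> h ` Q) (scm_T G) \<and> set v \<subseteq> syms (scm_N G \<union> h ` Q) (scm_T G)
        \<and> (\<exists>q \<in> Q. nt q \<in> set u)" if uv: "(u, v) \<in> sim_rules" for u v
  proof -
    have app: ?thesis if "rs \<in> Rs" "rs \<noteq> []" "u = [nt (App rs), Nt (fst (hd rs))]"
      "v = snd (hd rs) @ [nt (App (tl rs))]" for rs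
    proof -
      obtain A w rs' where [simp]: "rs = (A, w) # rs'"
        using \<open>rs \<noteq> []\<close> by (cases rs) auto
      show ?thesis
        using that(1,3,4) Rs_ConsD[of A w rs'] sub nt[of "App rs"] nt[of "App rs'"] Sigma_NtI
        by (auto simp: Q_intros)
    qed
    show ?thesis
      using uv sub start_in_Sigma
      unfolding sim_rules_def
      apply (elim UnE imageE SigmaE)
      subgoal using Nil_in_Rs by (elim insertE emptyE)
          (auto intro!: nt Q_intros intro: bexI[of _ Init] bexI[of _ "App []"] bexI[of _ RM])
      subgoal using Nil_in_Rs by (auto intro!: nt Q_intros bexI[of _ "App []"])
      subgoal by (auto intro!: nt Q_intros bexI[of _ "ChkF _"])
      subgoal by (auto intro!: nt Q_intros bexI[of _ RM])
      subgoal by (auto intro!: nt Q_intros bexI[of _ "ChkP _"])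
      subgoal using P_in_Sigma by (fastforce intro!: nt Q_intros mx_rules_in_Rs bexI[of _ "ChkP _"] split: option.splits)
      subgoal by (auto intro!: nt Q_intros bexI[of _ "App _"])
      subgoal by (auto intro!: nt Q_intros bexI[of _ "App _"])
      subgoal using app by auto
      done
  qed
  have "finite (scm_N G)" "finite (scm_T G)"
    using wf by (auto simp: scm_wf_def)
  then show ?thesis
    unfolding psg_wf_def sim_psg_def psg.simps
    using fin finite_Q * Q_intros(1) by fastforce
qed

section \<open>Soundness of the simulation\<close>

text \<open>In the middle of a matrix the word need not be derivable in \<open>G\<close>, so
  \<open>App rs\<close> only promises that every outcome of the remaining rules is. For
  \<open>App []\<close> this says that \<open>p @ s\<close> itself is reachable.\<close>

fun inv_head :: "'t head \<Rightarrow> 't sym list \<Rightarrow> 't sym list \<Rightarrow> bool" where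
  "inv_head (App rs) p s \<longleftrightarrow> rs \<in> Rs \<and> (\<forall>y. apply_rules rs (p @ s) y \<longrightarrow> reach y)"
| "inv_head (ChkF r) p s \<longleftrightarrow> r \<in> scm_M G \<and> reach (p @ s) \<and> (\<forall>f. mx_F r = Some [f] \<longrightarrow> f \<notin> set p)"
| "inv_head (ChkP r) p s \<longleftrightarrow> r \<in> scm_M G \<and> reach (p @ s) \<and> (\<forall>f. mx_F r = Some [f] \<longrightarrow> f \<notin> set (p @ s))"
| "inv_head _ p s \<longleftrightarrow> False"

text \<open>The tail \<rho> is optional because the right marker may be erased at any time; erasing
  it early only prevents later scans from ending.\<close>

inductive sim_inv :: "'t sym list \<Rightarrow> bool" where
  init: "sim_inv [nt Init]"
| final: "set y \<subseteq> \<Sigma> \<Longrightarrow> reach y \<Longrightarrow> \<rho> = [] \<or> \<rho> = [nt RM] \<Longrightarrow> sim_inv (y @ \<rho>)"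
| head: "set p \<subseteq> \<Sigma> \<Longrightarrow> set s \<subseteq> \<Sigma> \<Longrightarrow> inv_head q p s \<Longrightarrow> \<rho> = [] \<or> \<rho> = [nt RM]
    \<Longrightarrow> sim_inv (nt LM # p @ nt q # s @ \<rho>)"

lemma inv_head_Q: "inv_head q p s \<Longrightarrow> q \<in> Q \<and> q \<noteq> LM \<and> q \<noteq> RM \<and> q \<noteq> Init"
  by (cases q) (auto simp: Q_def)

text \<open>When the permitted word is found, the scan has already excluded the forbidden symbol, so
  a full run of the rules is one step of \<open>G\<close>.\<close>

lemma inv_headI_App:
  assumes r: "r \<in> scm_M G" and inv: "inv_head (ChkP r) p s"
    and P: "\<And>P. mx_P r = Some P \<Longrightarrow> sublist P (p @ s)"
  shows "inv_head (App (mx_rules r)) p s"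
proof -
  have "reach y" if "apply_rules (mx_rules r) (p @ s) y" for y
  proof -
    have "mx_step r (p @ s) y"
      unfolding mx_step_def
      using that P inv
      by (cases rule: mx_F_cases[OF r]) (auto split: option.splits dest: set_mono_sublist)
    then show ?thesis
      using r inv rtranclp.rtrancl_into_rtrancl[of "scm_step G" _ "p @ s" y] by (auto simp: scm_step_def)
  qed
  then show ?thesis
    using mx_rules_in_Rs[OF r] by simp
qed

text \<open>Since \<open>h\<close> is injective and avoids the nonterminals of \<open>G\<close>, a
  head state occurs only once in an invariant word, which makes the split around it unique.\<close>

lemma locate_head:
  assumes "sim_inv (p' @ nt q # q')" "q \<in> Q" "q \<noteq> Init" "q \<noteq> LM" "q \<noteq> RM"
  obtains p s \<rho> where "p' = nt LM # p" "q' = s @ \<rho>" "set p \<subseteq> \<Sigma>" "set s \<subseteq> \<Sigma>" "inv_head q p s"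
    "\<rho> = [] \<or> \<rho> = [nt RM]"
  using assms(1)
proof (cases rule: sim_inv.cases)
  case init
  then show ?thesis
    using nt_eqD[of q Init] assms by (auto simp: Q_intros Cons_eq_append_conv append_eq_Cons_conv)
next
  case (final y \<rho>)
  have "nt q \<in> set (p' @ nt q # q')"
    by simp
  then have "nt q \<in> set (y @ \<rho>)"
    unfolding final .
  then show ?thesis
    using final nt_notin_Sigma[OF assms(2)] nt_eqD[of q RM] assms by (auto simp: Q_intros)
next
  case (head p s q2 \<rho>)
  have q2: "q2 \<in> Q" "q2 \<noteq> LM" "q2 \<noteq> RM"
    using inv_head_Q[OF head(4)] by auto
  have "nt q \<in> set (p' @ nt q # q')"
    by simp
  then have "nt q \<in> set (nt LM # p @ nt q2 # s @ \<rho>)"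
    unfolding head(1) .
  then have "nt q = nt q2"
    using head nt_notin_Sigma[OF assms(2)] nt_eqD[of q RM] nt_eqD[of q LM] assms by (auto simp: Q_intros)
  then have [simp]: "q2 = q"
    using nt_eqD q2 assms by blast
  have "nt q \<notin> set (nt LM # p)" "nt q \<notin> set (s @ \<rho>)"
    using head nt_notin_Sigma[OF assms(2)] nt_eqD[of q RM] nt_eqD[of q LM] assms by (auto simp: Q_intros)
  then have "nt LM # p = p' \<and> s @ \<rho> = q'"
    using head(1) append_Cons_eq_iff[of "nt q" "nt LM # p" "s @ \<rho>" p' q'] by simp
  then show ?thesis
    using that head by auto
qed

lemma remove_RM:
  assumes "sim_inv (p' @ nt RM # q')"
  shows "sim_inv (p' @ q')"
  using assms
proof (cases rule: sim_inv.cases)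
  case init
  then show ?thesis
    using nt_eqD[of RM Init] by (auto simp: Q_intros Cons_eq_append_conv append_eq_Cons_conv)
next
  case (final y \<rho>)
  have "nt RM \<notin> set y"
    using final nt_notin_Sigma[of RM] by (auto simp: Q_intros)
  then have "y = p' \<and> q' = []"
    using final(1,4) append_Cons_eq_iff[of "nt RM" y "[]" p' q']
    by (metis append_Nil2 in_set_conv_decomp list.distinct(1) set_empty empty_iff)
  then show ?thesis
    using sim_inv.final[of y "[]"] final by auto
next
  case (head p s q \<rho>)
  have "nt RM \<notin> set (nt LM # p @ nt q # s)"
    using head nt_notin_Sigma[of RM] nt_eqD[of RM LM] nt_eqD[of RM q] inv_head_Q[OF head(4)]
    by (auto simp: Q_intros)
  moreover have "(nt LM # p @ nt q # s) @ \<rho> = p' @ nt RM # q'"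
    using head(1) by simp
  ultimately have "nt LM # p @ nt q # s = p' \<and> q' = []"
    using head(5) append_Cons_eq_iff[of "nt RM" "nt LM # p @ nt q # s" "[]" p' q']
    by (metis append_Nil2 in_set_conv_decomp list.distinct(1) set_empty empty_iff)
  then show ?thesis
    using sim_inv.head[of p s q "[]"] head by auto
qed

lemma locate_Init:
  assumes "sim_inv (p' @ nt Init # q')"
  shows "p' = [] \<and> q' = []"
  using assms
proof (cases rule: sim_inv.cases)
  case init
  then show ?thesis
    by (auto simp: Cons_eq_append_conv append_eq_Cons_conv)
next
  case (final y \<rho>)
  have "nt Init \<in> set (p' @ nt Init # q')"
    by simp
  then have "nt Init \<in> set (y @ \<rho>)"
    unfolding final .
  then show ?thesis
    using final nt_notin_Sigma[of Init] nt_eqD[of Init RM] by (auto simp: Q_intros)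
next
  case (head p s q \<rho>)
  have "nt Init \<in> set (p' @ nt Init # q')"
    by simp
  then have "nt Init \<in> set (nt LM # p @ nt q # s @ \<rho>)"
    unfolding head(1) .
  then show ?thesis
    using head nt_notin_Sigma[of Init] nt_eqD[of Init RM] nt_eqD[of Init LM] nt_eqD[of Init q]
      inv_head_Q[OF head(4)]
    by (auto simp: Q_intros)
qed

lemma RM_notin: "set s \<subseteq> \<Sigma> \<Longrightarrow> nt RM \<notin> set s"
  using nt_notin_Sigma[of RM] by (auto simp: Q_intros)

lemma LM_notin: "set s \<subseteq> \<Sigma> \<Longrightarrow> nt LM \<notin> set s"
  using nt_notin_Sigma[of LM] by (auto simp: Q_intros)

text \<open>A word over \<Sigma> cannot reach into the right marker, so a rule consuming it stays
  within the simulated sentential form.\<close>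

lemma split_right:
  assumes "u @ q' = s @ \<rho>" "set u \<subseteq> \<Sigma>" "\<rho> = [] \<or> \<rho> = [nt RM]"
  obtains s' where "s = u @ s'" "q' = s' @ \<rho>"
  using assms RM_notin[OF assms(2)] by (auto simp: append_eq_append_conv2 append_eq_Cons_conv)

lemma split_left:
  assumes "p' @ [c] = nt LM # p" "c \<in> \<Sigma>"
  obtains p2 where "p = p2 @ [c]" "p' = nt LM # p2"
  using assms nt_notin_Sigma[of LM]
  by (cases p' ) (auto simp: Q_intros)

lemma split_left_LM:
  assumes "p' @ [nt LM] = nt LM # p" "set p \<subseteq> \<Sigma>"
  shows "p = []" "p' = []"
  using assms LM_notin[OF assms(2)] by (cases p'; auto)+

lemma sim_inv_step:
  assumes inv: "sim_inv x" and step: "psg_step sim_psg x y"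
  shows "sim_inv y"
proof -
  obtain p' q' u v where uv: "(u, v) \<in> sim_rules" and x: "x = p' @ u @ q'" and y: "y = p' @ v @ q'"
    using step by (auto simp: psg_step_def sim_psg_def)
  have inv': "sim_inv (p' @ u @ q')"
    using inv x by simp
  consider (Init) "u = [nt Init]" "v = [nt LM, nt (App []), Nt (scm_S G), nt RM]"
    | (RM) "u = [nt RM]" "v = []"
    | (LM) "u = [nt LM, nt (App [])]" "v = []"
    | (toF) r where "r \<in> scm_M G" "u = [nt LM, nt (App [])]" "v = [nt LM, nt (ChkF r)]"
    | (F) r c where "r \<in> scm_M G" "c \<in> \<Sigma>" "mx_F r \<noteq> Some [c]" "u = [nt (ChkF r), c]" "v = [c, nt (ChkF r)]"
    | (toP) r where "r \<in> scm_M G" "u = [nt (ChkF r), nt RM]" "v = [nt (ChkP r), nt RM]"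
    | (P) r c where "r \<in> scm_M G" "c \<in> \<Sigma>" "u = [c, nt (ChkP r)]" "v = [nt (ChkP r), c]"
    | (toApp) r P where "r \<in> scm_M G" "u = nt (ChkP r) # P" "v = nt (App (mx_rules r)) # P"
        "P = (case mx_P r of None \<Rightarrow> [] | Some P \<Rightarrow> P)"
    | (right) rs c where "rs \<in> Rs" "c \<in> \<Sigma>" "u = [nt (App rs), c]" "v = [c, nt (App rs)]"
    | (left) rs c where "rs \<in> Rs" "c \<in> \<Sigma>" "u = [c, nt (App rs)]" "v = [nt (App rs), c]"
    | (App) A w rs where "(A, w) # rs \<in> Rs" "u = [nt (App ((A, w) # rs)), Nt A]" "v = w @ [nt (App rs)]"
  proof -
    have app: thesis if "rs \<in> Rs" "rs \<noteq> []" "u = [nt (App rs), Nt (fst (hd rs))]"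
      "v = snd (hd rs) @ [nt (App (tl rs))]" for rs
      using that App[of "fst (hd rs)" "snd (hd rs)" "tl rs"] by auto
    show thesis
      using uv unfolding sim_rules_def
      apply (elim UnE imageE SigmaE)
      subgoal using Init RM LM by auto
      subgoal using toF by auto
      subgoal using F by auto
      subgoal using toP by auto
      subgoal using P by auto
      subgoal for r by (rule toApp[of r]) simp_all
      subgoal using right by auto
      subgoal using left by auto
      subgoal using app by auto
      done
  qed
  then show ?thesis
  proof cases
    case Init
    then have [simp]: "p' = []" "q' = []"
      using inv' locate_Init by auto
    have "inv_head (App []) [] [Nt (scm_S G)]"
      by (simp add: Nil_in_Rs)
    then show ?thesis
      using sim_inv.head[of "[]" "[Nt (scm_S G)]" "App []" "[nt RM]"] start_in_Sigma Init y by simp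
  next
    case RM
    then show ?thesis
      using remove_RM inv' y by simp
  next
    case LM
    then obtain p s \<rho> where *: "p' @ [nt LM] = nt LM # p" "q' = s @ \<rho>" "set p \<subseteq> \<Sigma>" "set s \<subseteq> \<Sigma>"
      "inv_head (App []) p s" "\<rho> = [] \<or> \<rho> = [nt RM]"
      using inv' locate_head[of "p' @ [nt LM]" "App []" q'] Nil_in_Rs by (auto simp: Q_intros)
    then show ?thesis
      using split_left_LM[OF *(1,3)] LM y sim_inv.final[of s \<rho>] by simp
  next
    case (toF r)
    then obtain p s \<rho> where *: "p' @ [nt LM] = nt LM # p" "q' = s @ \<rho>" "set p \<subseteq> \<Sigma>" "set s \<subseteq> \<Sigma>"
      "inv_head (App []) p s" "\<rho> = [] \<or> \<rho> = [nt RM]"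
      using inv' locate_head[of "p' @ [nt LM]" "App []" q'] Nil_in_Rs by (auto simp: Q_intros)
    then show ?thesis
      using split_left_LM[OF *(1,3)] toF y sim_inv.head[of "[]" s "ChkF r" \<rho>] by simp
  next
    case (F r c)
    then obtain p s \<rho> where *: "p' = nt LM # p" "c # q' = s @ \<rho>" "set p \<subseteq> \<Sigma>" "set s \<subseteq> \<Sigma>"
      "inv_head (ChkF r) p s" "\<rho> = [] \<or> \<rho> = [nt RM]"
      using inv' locate_head[of p' "ChkF r" "c # q'"] by (auto simp: Q_intros)
    obtain s' where "s = c # s'" "q' = s' @ \<rho>"
      using split_right[of "[c]" q' s \<rho>] * F by auto
    then show ?thesis
      using * F y sim_inv.head[of "p @ [c]" s' "ChkF r" \<rho>] by auto
  next
    case (toP r)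
    then obtain p s \<rho> where *: "p' = nt LM # p" "nt RM # q' = s @ \<rho>" "set p \<subseteq> \<Sigma>" "set s \<subseteq> \<Sigma>"
      "inv_head (ChkF r) p s" "\<rho> = [] \<or> \<rho> = [nt RM]"
      using inv' locate_head[of p' "ChkF r" "nt RM # q'"] by (auto simp: Q_intros)
    \<comment> \<open>Only \<open>RM\<close> lies to the right of the head, so the letters already
      scanned are the whole sentential form.\<close>
    have "s = []"
      using *(2) RM_notin[OF *(4)] by (cases s) auto
    then show ?thesis
      using * toP y sim_inv.head[of p "[]" "ChkP r" \<rho>] by auto
  next
    case (P r c)
    then obtain p s \<rho> where *: "p' @ [c] = nt LM # p" "q' = s @ \<rho>" "set p \<subseteq> \<Sigma>" "set s \<subseteq> \<Sigma>"
      "inv_head (ChkP r) p s" "\<rho> = [] \<or> \<rho> = [nt RM]"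
      using inv' locate_head[of "p' @ [c]" "ChkP r" q'] by (auto simp: Q_intros)
    obtain p2 where "p = p2 @ [c]" "p' = nt LM # p2"
      using split_left[OF *(1)] P by auto
    then show ?thesis
      using * P y sim_inv.head[of p2 "c # s" "ChkP r" \<rho>] by auto
  next
    case (toApp r P)
    then obtain p s \<rho> where *: "p' = nt LM # p" "P @ q' = s @ \<rho>" "set p \<subseteq> \<Sigma>" "set s \<subseteq> \<Sigma>"
      "inv_head (ChkP r) p s" "\<rho> = [] \<or> \<rho> = [nt RM]"
      using inv' locate_head[of p' "ChkP r" "P @ q'"] by (auto simp: Q_intros)
    have "set P \<subseteq> \<Sigma>"
      using toApp P_in_Sigma by (auto split: option.splits)
    then obtain s' where s': "s = P @ s'" "q' = s' @ \<rho>"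
      using split_right[of P q' s \<rho>] * by auto
    have "inv_head (App (mx_rules r)) p s"
      using toApp * s' by (intro inv_headI_App) auto
    then show ?thesis
      using * toApp y s' sim_inv.head[of p s "App (mx_rules r)" \<rho>] by simp
  next
    case (right rs c)
    then obtain p s \<rho> where *: "p' = nt LM # p" "c # q' = s @ \<rho>" "set p \<subseteq> \<Sigma>" "set s \<subseteq> \<Sigma>"
      "inv_head (App rs) p s" "\<rho> = [] \<or> \<rho> = [nt RM]"
      using inv' locate_head[of p' "App rs" "c # q'"] by (auto simp: Q_intros)
    obtain s' where "s = c # s'" "q' = s' @ \<rho>"
      using split_right[of "[c]" q' s \<rho>] * right by auto
    then show ?thesis
      using * right y sim_inv.head[of "p @ [c]" s' "App rs" \<rho>] by auto
  next
    case (left rs c)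
    then obtain p s \<rho> where *: "p' @ [c] = nt LM # p" "q' = s @ \<rho>" "set p \<subseteq> \<Sigma>" "set s \<subseteq> \<Sigma>"
      "inv_head (App rs) p s" "\<rho> = [] \<or> \<rho> = [nt RM]"
      using inv' locate_head[of "p' @ [c]" "App rs" q'] by (auto simp: Q_intros)
    obtain p2 where "p = p2 @ [c]" "p' = nt LM # p2"
      using split_left[OF *(1)] left by auto
    then show ?thesis
      using * left y sim_inv.head[of p2 "c # s" "App rs" \<rho>] by auto
  next
    case (App A w rs)
    note R = Rs_ConsD[OF App(1)]
    obtain p s \<rho> where *: "p' = nt LM # p" "Nt A # q' = s @ \<rho>" "set p \<subseteq> \<Sigma>" "set s \<subseteq> \<Sigma>"
      "inv_head (App ((A, w) # rs)) p s" "\<rho> = [] \<or> \<rho> = [nt RM]"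
      using inv' locate_head[of p' "App ((A, w) # rs)" "Nt A # q'"] App by (auto simp: Q_intros)
    obtain s' where s': "s = Nt A # s'" "q' = s' @ \<rho>"
      using split_right[of "[Nt A]" q' s \<rho>] * R Sigma_NtI by auto
    \<comment> \<open>Rewriting \<open>A\<close> at the head is one of the choices that
      \<open>apply_rules\<close> allows, so the promise for the longer rule list specializes to the
      shorter one.\<close>
    have "inv_head (App rs) (p @ w) s'"
      using *(5) s' R(1) by auto
    then show ?thesis
      using * App y s' R sim_inv.head[of "p @ w" s' "App rs" \<rho>] by auto
  qed
qed

lemma sim_sound:
  assumes "w \<in> psg_lang sim_psg"
  shows "w \<in> scm_lang G"
proof -
  have w: "set w \<subseteq> scm_T G" "(psg_step sim_psg)\<^sup>*\<^sup>* [nt Init] (map Tm w)"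
    using assms by (auto simp: psg_lang_def sim_psg_def)
  from w(2) have "sim_inv (map Tm w)"
    by induction (auto intro: sim_inv.init sim_inv_step)
  \<comment> \<open>A word of terminals contains no head and no marker, so only \<open>final\<close>
    with an empty tail is left.\<close>
  then have "reach (map Tm w)"
  proof (cases rule: sim_inv.cases)
    case (final y \<rho>)
    then show ?thesis
      by (auto simp: map_eq_append_conv)
  qed (auto simp: map_eq_Cons_conv)
  then show ?thesis
    using w(1) by (auto simp: scm_lang_def)
qed

section \<open>Completeness of the simulation\<close>

abbreviation sim_reach (infix "\<leadsto>" 50) where
  "x \<leadsto> y \<equiv> (psg_step sim_psg)\<^sup>*\<^sup>* x y"

lemma sim_stepI: "(u, v) \<in> sim_rules \<Longrightarrow> p @ u @ q \<leadsto> p @ v @ q"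
  by (rule r_into_rtranclp) (auto simp: psg_step_def sim_psg_def)

lemma App_right:
  assumes "rs \<in> Rs" "set s \<subseteq> \<Sigma>"
  shows "p @ nt (App rs) # s @ q \<leadsto> p @ s @ nt (App rs) # q"
  using assms(2)
proof (induction s arbitrary: p)
  case (Cons c s)
  have "([nt (App rs), c], [c, nt (App rs)]) \<in> sim_rules"
    using Cons assms by (force simp: sim_rules_def)
  from sim_stepI[OF this, of p "s @ q"] Cons.IH[of "p @ [c]"] Cons.prems
  show ?case
    by auto
qed simp

lemma App_left:
  assumes "rs \<in> Rs" "set s \<subseteq> \<Sigma>"
  shows "p @ s @ nt (App rs) # q \<leadsto> p @ nt (App rs) # s @ q"
  using assms(2)
proof (induction s arbitrary: q rule: rev_induct)
  case (snoc c s)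
  have "([c, nt (App rs)], [nt (App rs), c]) \<in> sim_rules"
    using snoc assms by (force simp: sim_rules_def)
  from sim_stepI[OF this, of "p @ s" q] snoc.IH[of "c # q"] snoc.prems
  show ?case
    by auto
qed simp

lemma ChkF_right:
  assumes "r \<in> scm_M G" "set s \<subseteq> \<Sigma>" "\<And>c. c \<in> set s \<Longrightarrow> mx_F r \<noteq> Some [c]"
  shows "p @ nt (ChkF r) # s @ q \<leadsto> p @ s @ nt (ChkF r) # q"
  using assms(2,3)
proof (induction s arbitrary: p)
  case (Cons c s)
  have "([nt (ChkF r), c], [c, nt (ChkF r)]) \<in> sim_rules"
    using Cons.prems assms(1) by (force simp: sim_rules_def)
  from sim_stepI[OF this, of p "s @ q"] Cons.IH[of "p @ [c]"] Cons.prems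
  show ?case
    by auto
qed simp

lemma ChkP_left:
  assumes "r \<in> scm_M G" "set s \<subseteq> \<Sigma>"
  shows "p @ s @ nt (ChkP r) # q \<leadsto> p @ nt (ChkP r) # s @ q"
  using assms(2)
proof (induction s arbitrary: q rule: rev_induct)
  case (snoc c s)
  have "([c, nt (ChkP r)], [nt (ChkP r), c]) \<in> sim_rules"
    using snoc assms by (force simp: sim_rules_def)
  from sim_stepI[OF this, of "p @ s" q] snoc.IH[of "c # q"] snoc.prems
  show ?case
    by auto
qed simp

text \<open>After each rule the head returns to the left marker, so every rule starts from the same
  kind of configuration.\<close>

lemma sim_apply_rules:
  assumes "apply_rules rs x y" "rs \<in> Rs" "set x \<subseteq> \<Sigma>"
  shows "nt LM # nt (App rs) # x @ [nt RM] \<leadsto> nt LM # nt (App []) # y @ [nt RM] \<and> set y \<subseteq> \<Sigma>"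
  using assms
proof (induction rs arbitrary: x)
  case (Cons Aw rs)
  obtain A w where [simp]: "Aw = (A, w)"
    by (cases Aw)
  obtain u v where uv: "x = u @ [Nt A] @ v" "apply_rules rs (u @ w @ v) y"
    using Cons.prems by auto
  note R = Rs_ConsD[of A w rs]
  have sub: "set u \<subseteq> \<Sigma>" "set v \<subseteq> \<Sigma>" "set w \<subseteq> \<Sigma>" "rs \<in> Rs"
    using uv R Cons.prems by auto
  have "([nt (App (Aw # rs)), Nt A], w @ [nt (App rs)]) \<in> sim_rules"
    using Cons.prems(2) unfolding sim_rules_def by (force intro!: rev_image_eqI[of "Aw # rs"])
  from sim_stepI[OF this, of "nt LM # u" "v @ [nt RM]"]
  have "nt LM # u @ nt (App (Aw # rs)) # Nt A # v @ [nt RM] \<leadsto> nt LM # (u @ w) @ nt (App rs) # v @ [nt RM]"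
    by simp
  moreover have "nt LM # nt (App (Aw # rs)) # x @ [nt RM] \<leadsto> nt LM # u @ nt (App (Aw # rs)) # Nt A # v @ [nt RM]"
    using App_right[of "Aw # rs" u "[nt LM]" "Nt A # v @ [nt RM]"] sub Cons.prems(2) uv by simp
  moreover have "nt LM # (u @ w) @ nt (App rs) # v @ [nt RM] \<leadsto> nt LM # nt (App rs) # (u @ w @ v) @ [nt RM]"
    using App_left[of rs "u @ w" "[nt LM]" "v @ [nt RM]"] sub by simp
  moreover have "nt LM # nt (App rs) # (u @ w @ v) @ [nt RM] \<leadsto> nt LM # nt (App []) # y @ [nt RM] \<and> set y \<subseteq> \<Sigma>"
    using Cons.IH[OF uv(2)] sub by simp
  ultimately show ?case
    by (meson rtranclp_trans)
qed auto

text \<open>One matrix is one round trip: scan to the right marker, walk left to the permitted word,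
  return to the left marker and apply the rules.\<close>

lemma sim_step:
  assumes "scm_step G x y" "set x \<subseteq> \<Sigma>"
  shows "nt LM # nt (App []) # x @ [nt RM] \<leadsto> nt LM # nt (App []) # y @ [nt RM] \<and> set y \<subseteq> \<Sigma>"
proof -
  obtain r where r: "r \<in> scm_M G" and step: "mx_step r x y"
    using assms by (auto simp: scm_step_def)
  have "([nt LM, nt (App [])], [nt LM, nt (ChkF r)]) \<in> sim_rules"
    using r by (auto simp: sim_rules_def)
  from sim_stepI[OF this, of "[]" "x @ [nt RM]"]
  have 1: "nt LM # nt (App []) # x @ [nt RM] \<leadsto> nt LM # nt (ChkF r) # x @ [nt RM]"
    by simp
  have 2: "nt LM # nt (ChkF r) # x @ [nt RM] \<leadsto> nt LM # x @ [nt (ChkF r), nt RM]"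
  proof -
    have "mx_F r \<noteq> Some [c]" if "c \<in> set x" for c
      using that step split_list[of c x] by (force simp: mx_step_def sublist_def)
    then show ?thesis
      using ChkF_right[OF r assms(2), of "[nt LM]" "[nt RM]"] by simp
  qed
  have 3: "nt LM # x @ [nt (ChkF r), nt RM] \<leadsto> nt LM # x @ [nt (ChkP r), nt RM]"
  proof -
    have "([nt (ChkF r), nt RM], [nt (ChkP r), nt RM]) \<in> sim_rules"
      using r by (auto simp: sim_rules_def)
    from sim_stepI[OF this, of "nt LM # x" "[]"] show ?thesis
      by simp
  qed
  have 4: "nt LM # x @ [nt (ChkP r), nt RM] \<leadsto> nt LM # nt (App (mx_rules r)) # x @ [nt RM]"
  proof -
    define P where "P = (case mx_P r of None \<Rightarrow> [] | Some P \<Rightarrow> P)"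
    have "sublist P x"
      using step by (auto simp: P_def mx_step_def split: option.splits)
    then obtain a b where x: "x = a @ P @ b"
      by (auto simp: sublist_def)
    have "(nt (ChkP r) # P, nt (App (mx_rules r)) # P) \<in> sim_rules"
      using r by (auto simp: sim_rules_def P_def)
    from sim_stepI[OF this, of "nt LM # a" "b @ [nt RM]"]
    have "nt LM # a @ nt (ChkP r) # P @ b @ [nt RM] \<leadsto> nt LM # a @ nt (App (mx_rules r)) # P @ b @ [nt RM]"
      by simp
    moreover have "nt LM # x @ [nt (ChkP r), nt RM] \<leadsto> nt LM # a @ nt (ChkP r) # P @ b @ [nt RM]"
      using ChkP_left[OF r, of "P @ b" "nt LM # a" "[nt RM]"] assms(2) x by simp
    moreover have "nt LM # a @ nt (App (mx_rules r)) # P @ b @ [nt RM] \<leadsto> nt LM # nt (App (mx_rules r)) # x @ [nt RM]"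
      using App_left[of "mx_rules r" a "[nt LM]" "P @ b @ [nt RM]"] assms(2) x mx_rules_in_Rs[OF r] by simp
    ultimately show ?thesis
      by (meson rtranclp_trans)
  qed
  show ?thesis
    using rtranclp_trans[OF rtranclp_trans[OF 1 2] rtranclp_trans[OF 3 4]] sim_apply_rules[of "mx_rules r" x y] mx_rules_in_Rs[OF r] step assms(2)
    by (auto simp: mx_step_def intro: rtranclp_trans)
qed

lemma sim_complete:
  assumes "w \<in> scm_lang G"
  shows "w \<in> psg_lang sim_psg"
proof -
  have w: "set w \<subseteq> scm_T G" "reach (map Tm w)"
    using assms by (auto simp: scm_lang_def)
  have "nt LM # nt (App []) # [Nt (scm_S G)] @ [nt RM] \<leadsto> nt LM # nt (App []) # y @ [nt RM] \<and> set y \<subseteq> \<Sigma>"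
    if "reach y" for y
    using that
  proof induction
    case base
    show ?case
      using start_in_Sigma by simp
  next
    case (step y z)
    then show ?case
      using sim_step[of y z] by (meson rtranclp_trans)
  qed
  from this[OF w(2)]
  have "nt LM # nt (App []) # [Nt (scm_S G)] @ [nt RM] \<leadsto> nt LM # nt (App []) # map Tm w @ [nt RM]"
    by simp
  moreover have "[nt Init] \<leadsto> nt LM # nt (App []) # [Nt (scm_S G)] @ [nt RM]"
    using sim_stepI[of "[nt Init]" _ "[]" "[]"] by (auto simp: sim_rules_def)
  moreover have "nt LM # nt (App []) # map Tm w @ [nt RM] \<leadsto> map Tm w @ [nt RM]"
    using sim_stepI[of "[nt LM, nt (App [])]" "[]" "[]"] by (auto simp: sim_rules_def)
  moreover have "map Tm w @ [nt RM] \<leadsto> map Tm w"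
    using sim_stepI[of "[nt RM]" "[]" "map Tm w" "[]"] by (auto simp: sim_rules_def)
  ultimately have "[nt Init] \<leadsto> map Tm w"
    by (meson rtranclp_trans)
  then show ?thesis
    using w(1) by (auto simp: psg_lang_def sim_psg_def)
qed

end

section \<open>Fresh nonterminals and membership in \<open>RE\<close>\<close>

lemma finite_fresh_numbering:
  assumes "finite Q" "finite (N :: nat set)"
  obtains h where "inj_on h Q" "h ` Q \<inter> N = {}"
proof -
  obtain f :: "_ \<Rightarrow> nat" where f: "inj_on f Q"
    using finite_imp_inj_to_nat_seg[OF assms(1)] by blast
  \<comment> \<open>An injection into the naturals is shifted beyond every element of
    \<open>N\<close>; inserting 0 makes the maximum defined for empty \<open>N\<close>.\<close>
  let ?h = "\<lambda>q. f q + Suc (Max (insert 0 N))"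
  have "inj_on ?h Q"
    using f by (auto simp: inj_on_def)
  moreover have "?h q \<notin> N" for q
    using Max_ge[of "insert 0 N" "?h q"] assms(2) by (metis Suc_n_not_le_n add_leD2 finite_insert insertI2)
  ultimately show ?thesis
    using that by blast
qed

theorem scm_lang_in_RE:
  assumes wf: "scm_wf G" and F: "\<And>r. r \<in> scm_M G \<Longrightarrow> cond_len (mx_F r) \<le> 1"
  shows "scm_lang G \<in> RE"
proof -
  let ?Rs = "insert [] (\<Union>r\<in>scm_M G. set (suffixes (mx_rules r)))"
  let ?Q = "{Init, LM, RM} \<union> App ` ?Rs \<union> ChkF ` scm_M G \<union> ChkP ` scm_M G"
  have "finite ?Q" "finite (scm_N G)"
    using wf by (auto simp: scm_wf_def)
  then obtain h where h: "inj_on h ?Q" "h ` ?Q \<inter> scm_N G = {}"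
    by (rule finite_fresh_numbering)
  then interpret scm_simulation G h ?Rs ?Q "syms (scm_N G) (scm_T G)"
    using wf F by unfold_locales
  have "scm_lang G = psg_lang sim_psg"
    using sim_sound sim_complete by (intro set_eqI iffI)
  then show ?thesis
    unfolding RE_def using sim_psg_wf by blast
qed

section \<open>Matrix grammars check cancellation\<close>

text \<open>\<open>X\<close> grows at its right end and \<open>Y\<close> at its left end, just as
  rewriting \<open>S\<close> into \<open>u S v\<close> builds the words around \<open>S\<close>.
  \<open>Inl\<close> marks a letter that has to cancel, \<open>Inr\<close> an output
  terminal.\<close>

inductive gen :: "('l list \<times> ('l + 't) list) set \<Rightarrow> 'l list \<Rightarrow> ('l + 't) list \<Rightarrow> bool" for P where
  gen_Nil: "gen P [] []"
| gen_step: "gen P X Y \<Longrightarrow> (u, v) \<in> P \<Longrightarrow> gen P (X @ u) (v @ Y)"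

text \<open>The symbol \<open>nD\<close> is the mark \<open>$\<close>.\<close>

abbreviation "nS \<equiv> Nt 0"
abbreviation "nA \<equiv> Nt 1"
abbreviation "nB \<equiv> Nt 2"
abbreviation "nC \<equiv> Nt 3"
abbreviation "nD \<equiv> Nt 4"

section \<open>Cancelling partners and positions of factors\<close>

definition flip :: "'t sym \<Rightarrow> 't sym" where
  "flip k = (if k = nA then nB else k)"

text \<open>For \<open>z\<close> over \<open>A\<close> and \<open>C\<close>, the word
  \<open>z @ bar z\<close> disappears pair by pair from the middle outwards.\<close>

definition bar :: "'t sym list \<Rightarrow> 't sym list" where
  "bar z = map flip (rev z)"

text \<open>\<open>(nB, nA)\<close> counts as a cancelling pair too, because a matrix marks an
  \<open>A\<close> and a \<open>B\<close> in either order.\<close>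

definition noncancel :: "'t sym \<Rightarrow> 't sym \<Rightarrow> bool" where
  "noncancel k k' \<longleftrightarrow> (k, k') \<notin> {(nA, nB), (nB, nA), (nC, nC)}"

lemma bar_simps [simp]: "bar [] = []" "bar (z @ z') = bar z' @ bar z" "bar (k # z) = bar z @ [flip k]"
  by (simp_all add: bar_def)

lemma successively_adjacent: "successively R (p @ k # k' # r) \<Longrightarrow> R k k'"
  by (auto simp: successively_append_iff)

lemma successively_replicate: "R a a \<Longrightarrow> successively R (replicate n a)"
  by (induction n) (auto simp: successively_Cons, metis hd_replicate)

lemma append_Cons_eq_split:
  assumes "u @ d # v = u' @ b # v'" "d \<noteq> b"
  obtains m where "u = u' @ b # m" "v' = m @ d # v" | m where "v = m @ b # v'" "u' = u @ d # m"
  using assms by (auto simp: append_eq_append_conv2 append_eq_Cons_conv Cons_eq_append_conv)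

lemma append_eq_adjacent:
  assumes "x @ y = p @ k # k' # r"
  obtains m where "x = p @ k # k' # m" | "x = p @ [k]" "y = k' # r"
  | m where "p = x @ m" "y = m @ k # k' # r"
proof -
  from assms consider m where "x = p @ m" "m @ y = k # k' # r" | m where "p = x @ m" "y = m @ k # k' # r"
    by (auto simp: append_eq_append_conv2)
  then show thesis
  proof cases
    case (1 m)
    then show ?thesis
      using that by (cases m rule: list.exhaust; cases "tl m") auto
  qed (use that in blast)
qed

text \<open>The condition on \<open>d\<close> keeps the second rule away from the symbol just
  written, so two different positions of \<open>s\<close> are rewritten.\<close>

lemma apply_two_rules:
  assumes "apply_rules [(a, [d]), (b, [d])] s t" "d \<noteq> Nt b"
  obtains p q r k k' where "s = p @ k # q @ k' # r" "t = p @ d # q @ d # r"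
    "k = Nt a \<and> k' = Nt b \<or> k = Nt b \<and> k' = Nt a"
proof -
  obtain u v u' v' where *: "s = u @ Nt a # v" "u @ d # v = u' @ Nt b # v'" "t = u' @ d # v'"
    using assms(1) by auto
  from append_Cons_eq_split[OF *(2) assms(2)] show ?thesis
    by (cases; use * that in force)
qed

text \<open>Pairs of \<open>P\<close> may be used repeatedly; a pair of \<open>Fin\<close> removes
  \<open>S\<close> and comes last. Excluding the empty pair makes every right-hand side for
  \<open>S\<close> nonempty, so that misplaced marks around \<open>S\<close> stay apart.\<close>

locale cancellation =
  fixes T :: "'t set" and code :: "'l \<Rightarrow> nat" and \<Gamma> :: "'l set"
    and P Fin :: "('l list \<times> ('l + 't) list) set"
  assumes finite_T: "finite T" and finite_P: "finite P" and finite_Fin: "finite Fin"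
    and inj_code: "inj_on code \<Gamma>"
    and letters: "\<And>u v. (u, v) \<in> P \<union> Fin \<Longrightarrow> set u \<subseteq> \<Gamma> \<and> set v \<subseteq> Inl ` \<Gamma> \<union> Inr ` T"
    and nonempty: "([], []) \<notin> P \<union> Fin"
begin

section \<open>Unary coding of the queue letters\<close>

text \<open>The positive exponent separates any two \<open>C\<close> of the same code word, so that
  \<open>CC\<close> can arise only at the border of the two words.\<close>

definition lcode :: "'l list \<Rightarrow> 't sym list" where
  "lcode X = concat (map (\<lambda>k. replicate (Suc (code k)) nA @ [nC]) X)"

definition rcode1 :: "'l + 't \<Rightarrow> 't sym list" where
  "rcode1 y = (case y of Inl k \<Rightarrow> nC # replicate (Suc (code k)) nB | Inr a \<Rightarrow> [Tm a])"

definition rcode :: "('l + 't) list \<Rightarrow> 't sym list" where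
  "rcode Y = concat (map rcode1 Y)"

lemma lcode_simps [simp]:
  "lcode [] = []" "lcode (k # X) = replicate (Suc (code k)) nA @ nC # lcode X"
  "lcode (X @ X') = lcode X @ lcode X'"
  by (simp_all add: lcode_def)

lemma rcode_simps [simp]:
  "rcode [] = []" "rcode (Inl k # Y) = nC # replicate (Suc (code k)) nB @ rcode Y"
  "rcode (Inr a # Y) = Tm a # rcode Y" "rcode (Y @ Y') = rcode Y @ rcode Y'"
  by (simp_all add: rcode_def rcode1_def)

lemma rcode_map_Inr [simp]: "rcode (map Inr w) = map Tm w"
  by (induction w) auto

lemma lcode_Nil_iff [simp]: "lcode X = [] \<longleftrightarrow> X = []"
  by (cases X) auto

lemma rcode_Nil_iff [simp]: "rcode Y = [] \<longleftrightarrow> Y = []"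
  by (cases Y rule: list.exhaust; cases "hd Y") auto

text \<open>The partner of the block \<open>A^(k+1) C\<close> is the block \<open>C B^(k+1)\<close>,
  so a left word is cancelled by the right code of the same letters in reverse order.\<close>

lemma bar_lcode: "bar (lcode X) = rcode (map Inl (rev X))"
proof (induction X)
  case (Cons k X)
  have "bar (replicate n nA) = (replicate n nB :: 't sym list)" for n
    by (simp add: bar_def flip_def)
  then show ?case
    using Cons by (simp add: flip_def del: replicate_Suc)
qed simp

lemma set_lcode: "set (lcode X) \<subseteq> {nA, nC}"
  by (induction X) auto

lemma set_rcode: "set (rcode Y) \<subseteq> {nB, nC} \<union> Tm ` Inr -` set Y"
proof (induction Y)
  case (Cons y Y)
  then show ?case by (cases y) auto
qed simp

lemma set_rcode': "set (rcode Y) \<subseteq> {nB, nC} \<union> range Tm"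
  using set_rcode by blast

lemma successively_lcode: "successively noncancel (lcode X)"
proof (induction X)
  case (Cons k X)
  have "lcode X = [] \<or> hd (lcode X) = nA"
    by (cases X) auto
  then show ?case
    using Cons by (auto simp: successively_append_iff successively_Cons successively_replicate
        noncancel_def simp del: replicate_Suc)
qed simp

lemma successively_rcode: "successively noncancel (rcode Y)"
proof (induction Y)
  case (Cons y Y)
  have hd: "rcode Y = [] \<or> hd (rcode Y) \<in> {nC} \<union> range Tm"
    by (cases Y rule: list.exhaust; cases "hd Y") auto
  show ?case
  proof (cases y)
    case (Inl k)
    have "successively noncancel (replicate (Suc (code k)) nB @ rcode Y)"
      using Cons hd by (auto simp: successively_append_iff successively_replicate noncancel_def
        simp del: replicate_Suc)
    then show ?thesis
      using Inl by (auto simp: successively_Cons noncancel_def)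
  next
    case (Inr a)
    then show ?thesis
      using Cons by (auto simp: successively_Cons noncancel_def)
  qed
qed simp

text \<open>A block of \<open>B\<close> is followed by \<open>C\<close>, a terminal or the end, so
  its length can be read off, and by injectivity of \<open>code\<close> so can its letter.\<close>

lemma rcode_inj:
  assumes "rcode Y = rcode Y'" "set Y \<subseteq> Inl ` \<Gamma> \<union> range Inr" "set Y' \<subseteq> Inl ` \<Gamma> \<union> range Inr"
  shows "Y = Y'"
  using assms
proof (induction Y arbitrary: Y')
  case (Cons y Y)
  then obtain y' Z where Y': "Y' = y' # Z"
    by (cases Y') (auto dest: arg_cong[where f = "(=) []"])
  have hd: "takeWhile (\<lambda>c. c = nB) (rcode Y) = []" for Y
    by (cases Y rule: list.exhaust; cases "hd Y") auto
  have len: "length (takeWhile (\<lambda>c. c = nB) (replicate n nB @ rcode Y)) = n" for n Y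
    using hd[of Y] by (simp add: takeWhile_append)
  show ?case
  proof (cases y)
    case (Inl k)
    then obtain k' where y': "y' = Inl k'"
      using Cons.prems Y' by (cases y') auto
    have eq: "replicate (Suc (code k)) nB @ rcode Y = replicate (Suc (code k')) nB @ rcode Z"
      using Cons.prems(1) Y' Inl y' by simp
    then have c: "Suc (code k) = Suc (code k')"
      using len by metis
    then have "k = k'"
      using Cons.prems Inl y' Y' inj_code by (auto dest: inj_onD)
    moreover have "rcode Y = rcode Z"
      using eq c by simp
    ultimately show ?thesis
      using Cons Inl y' Y' by auto
  next
    case (Inr a)
    then have "y' = Inr a"
      using Cons.prems Y' by (cases y') auto
    then show ?thesis
      using Cons Inr Y' by auto
  qed
qed (use rcode_Nil_iff in metis)

section \<open>The cancelling matrix grammar\<close>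

text \<open>\<open>X\<close> and \<open>Y\<close> are the uncoded words on the two sides of
  \<open>S\<close> at the moment when it disappears.\<close>

definition fin :: "'l list \<Rightarrow> ('l + 't) list \<Rightarrow> bool" where
  "fin X Y \<longleftrightarrow> (\<exists>X' Y' u v. gen P X' Y' \<and> (u, v) \<in> Fin \<and> X = X' @ u \<and> Y = v @ Y')"

definition free_matrix :: "'t sym list \<Rightarrow> 't matrix" where
  "free_matrix w = \<lparr>mx_rules = [(0, w)], mx_P = None, mx_F = None\<rparr>"

text \<open>Forbidding \<open>$\<close> in both marking matrices allows at most two marks at a time,
  so \<open>erase_DD\<close>, which requires \<open>$$\<close>, removes exactly the pair just
  marked.\<close>

definition mark_AB :: "'t matrix" where
  "mark_AB = \<lparr>mx_rules = [(1, [nD]), (2, [nD])], mx_P = None, mx_F = Some [nD]\<rparr>"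

definition mark_CC :: "'t matrix" where
  "mark_CC = \<lparr>mx_rules = [(3, [nD]), (3, [nD])], mx_P = None, mx_F = Some [nD]\<rparr>"

definition erase_DD :: "'t matrix" where
  "erase_DD = \<lparr>mx_rules = [(4, []), (4, [])], mx_P = Some [nD, nD], mx_F = None\<rparr>"

definition rhss :: "'t sym list set" where
  "rhss = (\<lambda>(u, v). lcode u @ nS # rcode v) ` P \<union> (\<lambda>(u, v). lcode u @ rcode v) ` Fin"

definition canc_scm :: "'t scmg" where
  "canc_scm = \<lparr>scm_N = {0, 1, 2, 3, 4}, scm_T = T, scm_S = 0,
     scm_M = free_matrix ` rhss \<union> {mark_AB, mark_CC, erase_DD}\<rparr>"

lemmas matrix_defs = free_matrix_def mark_AB_def mark_CC_def erase_DD_def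

lemma rhss_nonempty: "w \<in> rhss \<Longrightarrow> w \<noteq> []"
  using nonempty by (auto simp: rhss_def)

lemma rhss_symbols: 
  assumes "w \<in> rhss" shows "set w \<subseteq> Tm ` T \<union> {nS, nA, nB, nC}"
proof -
  obtain u v where uv: "(u, v) \<in> P \<union> Fin" "set w \<subseteq> {nS} \<union> set (lcode u) \<union> set (rcode v)"
    using assms unfolding rhss_def by fastforce
  then have "Inr -` set v \<subseteq> T"
    using letters by blast
  then show ?thesis
    using uv set_lcode[of u] set_rcode[of v] by blast
qed

lemma canc_scm_wf: "scm_wf canc_scm"
proof -
  have "finite rhss"
    using finite_P finite_Fin by (simp add: rhss_def)
  moreover have "set w \<subseteq> syms {0, 1, 2, 3, 4} T" if "w \<in> rhss" for w
    using rhss_symbols[OF that] by (auto simp: syms_def)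
  moreover have "nD \<in> syms {0, 1, 2, 3, 4} T"
    by (simp add: syms_def)
  ultimately show ?thesis
    using finite_T by (auto simp: scm_wf_def canc_scm_def matrix_defs cond_ok_def)
qed

text \<open>Only the two marking matrices and the erasing matrix carry a condition, and each of them
  carries just one.\<close>

lemma canc_scm_bounds:
  "r \<in> scm_M canc_scm \<Longrightarrow> cond_len (mx_P r) \<le> 2 \<and> cond_len (mx_F r) \<le> 1 \<and> length (mx_rules r) \<le> 2"
  "card (scm_N canc_scm) \<le> 5"
  "card {r \<in> scm_M canc_scm. conditional r} \<le> 3"
  "card {r \<in> scm_M canc_scm. non_simple r} \<le> 0"
proof -
  have "{r \<in> scm_M canc_scm. conditional r} \<subseteq> {mark_AB, mark_CC, erase_DD}"
    by (auto simp: canc_scm_def matrix_defs conditional_def)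
  from card_mono[OF _ this] show "card {r \<in> scm_M canc_scm. conditional r} \<le> 3"
    using card_length[of "[mark_AB, mark_CC, erase_DD]"] by simp
  have "{r \<in> scm_M canc_scm. non_simple r} = {}"
    by (auto simp: canc_scm_def matrix_defs non_simple_def)
  then show "card {r \<in> scm_M canc_scm. non_simple r} \<le> 0"
    by (metis card.empty order_refl)
qed (auto simp: canc_scm_def matrix_defs cond_len_def)

section \<open>The invariant of the cancelling grammar\<close>

text \<open>In \<open>shrinking\<close>, \<open>z\<close> is the part of the left code already
  deleted against \<open>bar z\<close>. In \<open>marked\<close>, the next partner pair at the
  border carries the marks. In \<open>dead\<close>, the marks are separated by \<open>q\<close>,
  which no step can empty.\<close>

inductive canc_inv :: "'t sym list \<Rightarrow> bool" where
  growing: "gen P X Y \<Longrightarrow> canc_inv (lcode X @ nS # rcode Y)"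
| shrinking: "fin X Y \<Longrightarrow> lcode X = x @ z \<Longrightarrow> rcode Y = bar z @ y \<Longrightarrow> canc_inv (x @ y)"
| marked: "fin X Y \<Longrightarrow> lcode X = x @ k # z \<Longrightarrow> rcode Y = bar z @ flip k # y \<Longrightarrow> canc_inv (x @ nD # nD # y)"
| dead: "q \<noteq> [] \<Longrightarrow> nD \<notin> set (p @ q @ r) \<Longrightarrow> canc_inv (p @ nD # q @ nD # r)"

lemma canc_step_cases:
  assumes "scm_step canc_scm s t"
  obtains (free) u v w where "w \<in> rhss" "s = u @ nS # v" "t = u @ w @ v"
  | (mark) p q r k k' where "nD \<notin> set s" "s = p @ k # q @ k' # r" "t = p @ nD # q @ nD # r" "\<not> noncancel k k'"
  | (erase) "sublist [nD, nD] s" "apply_rules [(4, []), (4, [])] s t"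
proof -
  obtain m where m: "m \<in> free_matrix ` rhss \<union> {mark_AB, mark_CC, erase_DD}" "mx_step m s t"
    using assms by (auto simp: scm_step_def canc_scm_def)
  have notin: "nD \<notin> set s" if "\<not> sublist [nD] s"
    using that by (auto simp: sublist_def in_set_conv_decomp)
  show thesis
    using m(1)
  proof (elim UnE insertE emptyE imageE)
    fix w assume "m = free_matrix w" "w \<in> rhss"
    then show thesis
      using m(2) free by (auto simp: mx_step_def matrix_defs)
  next
    assume "m = mark_AB"
    then have "\<not> sublist [nD] s" "apply_rules [(1, [nD]), (2, [nD])] s t"
      using m(2) by (auto simp: mx_step_def matrix_defs)
    then show thesis
    proof (elim apply_two_rules)
      fix p q r k k'
      assume "\<not> sublist [nD] s" "s = p @ k # q @ k' # r" "t = p @ nD # q @ nD # r" "k = nA \<and> k' = nB \<or> k = nB \<and> k' = nA"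
      then show thesis
        using notin by (intro mark) (auto simp: noncancel_def)
    qed simp
  next
    assume "m = mark_CC"
    then have "\<not> sublist [nD] s" "apply_rules [(3, [nD]), (3, [nD])] s t"
      using m(2) by (auto simp: mx_step_def matrix_defs)
    then show thesis
    proof (elim apply_two_rules)
      fix p q r k k'
      assume "\<not> sublist [nD] s" "s = p @ k # q @ k' # r" "t = p @ nD # q @ nD # r" "k = nC \<and> k' = nC \<or> k = nC \<and> k' = nC"
      then show thesis
        using notin by (intro mark) (auto simp: noncancel_def)
    qed simp
  next
    assume "m = erase_DD"
    then show thesis
      using m(2) erase by (auto simp: mx_step_def matrix_defs)
  qed
qed

lemma sym_notin_codes:
  "nS \<notin> set (lcode X)" "nS \<notin> set (rcode Y)" "nD \<notin> set (lcode X)" "nD \<notin> set (rcode Y)"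
  using set_lcode[of X] set_rcode'[of Y] by auto

lemma canc_inv_step:
  assumes "canc_inv s" "scm_step canc_scm s t"
  shows "canc_inv t"
  using assms(1)
proof (cases rule: canc_inv.cases)
  case (growing X Y)
  from assms(2) show ?thesis
  proof (cases rule: canc_step_cases)
    case (free u v w)
    have "u = lcode X" "v = rcode Y"
      using free(2) growing(1) append_Cons_eq_iff[of nS "lcode X" "rcode Y" u v] sym_notin_codes by auto
    from free(1) show ?thesis
      unfolding rhss_def
    proof (elim UnE imageE, goal_cases)
      case (1 uv)
      then have "gen P (X @ fst uv) (snd uv @ Y)"
        using growing(2) by (intro gen_step) auto
      from canc_inv.growing[OF this] show ?case
        using 1 free \<open>u = _\<close> \<open>v = _\<close> by (cases uv) auto
    next
      case (2 uv)
      then have "fin (X @ fst uv) (snd uv @ Y)"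
        using growing(2) unfolding fin_def by (cases uv) auto
      from canc_inv.shrinking[OF this, of "lcode (X @ fst uv)" "[]" "rcode (snd uv @ Y)"] show ?case
        using 2 free \<open>u = _\<close> \<open>v = _\<close> by (cases uv) auto
    qed
  next
    case (mark p q r k k')
    \<comment> \<open>\<open>S\<close> cancels with nothing and separates the two code words, so
      marks set while it is present are never adjacent.\<close>
    have "successively noncancel s"
      using growing successively_lcode[of X] successively_rcode[of Y]
      by (auto simp: successively_append_iff successively_Cons noncancel_def)
    then have "q \<noteq> []"
      using mark successively_adjacent[of noncancel p k k' r] by auto
    then show ?thesis
      using mark canc_inv.dead[of q p r] by auto
  next
    case erase
    then have "nD \<in> set s"
      by (auto simp: sublist_def)
    then show ?thesis
      using growing sym_notin_codes by auto
  qed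
next
  case (shrinking X Y x z y)
  have x: "set x \<subseteq> {nA, nC}" "successively noncancel x"
    using set_lcode[of X] successively_lcode[of X] shrinking(3) by (auto simp: successively_append_iff)
  have y: "set y \<subseteq> {nB, nC} \<union> range Tm" "successively noncancel y"
    using set_rcode'[of Y] successively_rcode[of Y] shrinking(4) by (auto simp: successively_append_iff)
  from assms(2) show ?thesis
  proof (cases rule: canc_step_cases)
    case (free u v w)
    then have "nS \<in> set (x @ y)"
      using shrinking(1) by (metis in_set_conv_decomp)
    then show ?thesis
      using x y by auto
  next
    case (mark p q r k k')
    show ?thesis
    proof (cases "q = []")
      case False
      then show ?thesis
        using mark canc_inv.dead[of q p r] by auto
    next
      case True
      then have "x @ y = p @ k # k' # r"
        using mark shrinking by simp
      then consider m where "x = p @ k # k' # m" | "x = p @ [k]" "y = k' # r"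
        | m where "p = x @ m" "y = m @ k # k' # r"
        by (rule append_eq_adjacent)
      then show ?thesis
      proof cases
        case (1 m)
        then show ?thesis
          using mark(4) x successively_adjacent[of noncancel p k k' m] by simp
      next
        case 2
        \<comment> \<open>The pair straddles the border, where the admissible symbols on either side
          leave only partners as a cancelling pair.\<close>
        then have "k \<in> {nA, nC}" "k' \<in> {nB, nC} \<union> range Tm"
          using x y by auto
        then have "k' = flip k"
          using mark(4) by (auto simp: noncancel_def flip_def)
        then show ?thesis
          using canc_inv.marked[OF shrinking(2), of p k z r] shrinking(3,4) 2 mark True by simp
      next
        case (3 m)
        then show ?thesis
          using mark(4) y successively_adjacent[of noncancel m k k' r] by simp
      qed
    qed
  next
    case erase
    then have "nD \<in> set s"
      by (auto simp: sublist_def)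
    then show ?thesis
      using shrinking(1) x y by auto
  qed
next
  case (marked X Y x k z y)
  have x: "set x \<subseteq> {nA, nC}"
    using set_lcode[of X] marked(3) by auto
  have y: "set y \<subseteq> {nB, nC} \<union> range Tm"
    using set_rcode'[of Y] marked(4) by auto
  have D: "nD \<notin> set x" "nD \<notin> set y"
    using x y by auto
  from assms(2) show ?thesis
  proof (cases rule: canc_step_cases)
    case (free u v w)
    then have "nS \<in> set (x @ nD # nD # y)"
      using marked(1) by (metis in_set_conv_decomp)
    then show ?thesis
      using x y by auto
  next
    case mark
    have "nD \<in> set s"
      using marked(1) by simp
    then show ?thesis
      using mark(1) by contradiction
  next
    case erase
    obtain u v u' v' where uv: "x @ nD # nD # y = u @ nD # v" "u @ v = u' @ nD # v'" "t = u' @ v'"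
      using erase(2) marked(1) by auto
    \<comment> \<open>Whichever mark the first rule erases, the same word remains, with a single
      mark left for the second rule.\<close>
    have "u @ v = x @ nD # y"
      using uv(1)[symmetric]
    proof (rule append_eq_adjacent)
      fix m assume "x = u @ m" "nD # v = m @ nD # nD # y"
      then show ?thesis
        using D by (cases m) auto
    qed (use D uv(1) in auto)
    then have "u' = x" "v' = y"
      using uv(2) D append_Cons_eq_iff[of nD x y u' v'] by auto
    then show ?thesis
      using canc_inv.shrinking[OF marked(2), of x "k # z" y] marked uv by simp
  qed
next
  case (dead q p r)
  from assms(2) show ?thesis
  proof (cases rule: canc_step_cases)
    case (free u v w)
    have D: "nD \<notin> set w"
      using rhss_symbols[OF free(1)] by auto
    have "u @ nS # v = p @ nD # (q @ nD # r)"
      using free dead by simp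
    then show ?thesis
    proof (rule append_Cons_eq_split)
      fix m assume m: "u = p @ nD # m" "q @ nD # r = m @ nS # v"
      from m(2)[symmetric] show ?thesis
      proof (rule append_Cons_eq_split)
        fix m' assume "m = q @ nD # m'" "r = m' @ nS # v"
        then show ?thesis
          using canc_inv.dead[of q p "m' @ w @ v"] dead free m D by simp
      next
        \<comment> \<open>\<open>S\<close> lies between the marks; its nonempty replacement keeps
          them apart.\<close>
        fix m' assume "v = m' @ nD # r" "q = m @ nS # m'"
        then show ?thesis
          using canc_inv.dead[of "m @ w @ m'" p r] dead free m D rhss_nonempty[OF free(1)] by simp
      qed simp
    next
      fix m assume "v = m @ nD # q @ nD # r" "p = u @ nS # m"
      then show ?thesis
        using canc_inv.dead[of q "u @ w @ m" r] dead free D by simp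
    qed simp
  next
    case mark
    have "nD \<in> set s"
      using dead(1) by simp
    then show ?thesis
      using mark(1) by contradiction
  next
    case erase
    \<comment> \<open>There are only two marks, with a nonempty \<open>q\<close> between them, so
      \<open>$$\<close> cannot occur.\<close>
    then obtain a b where "p @ nD # q @ nD # r = a @ nD # nD # b"
      using dead(1) by (auto simp: sublist_def)
    then have False
    proof (rule append_eq_adjacent)
      fix m assume "a = p @ m" and m: "nD # q @ nD # r = m @ nD # nD # b"
      show False
      proof (cases m)
        case Nil
        then show False
          using m dead(2,3) by (cases q) auto
      next
        case (Cons c m')
        have "q @ nD # r = m' @ nD # nD # b"
          using m unfolding Cons append_Cons list.inject by (rule conjunct2)
        then show False
        proof (rule append_eq_adjacent)
          fix m assume "nD # r = m @ nD # nD # b"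
          then show False
            using dead(3) by (cases m) auto
        qed (use dead(3) in auto)
      qed
    qed (use dead(3) in auto)
    then show ?thesis ..
  qed
qed

section \<open>Generated terminal words come from solutions\<close>

lemma gen_letters: "gen P X Y \<Longrightarrow> set X \<subseteq> \<Gamma> \<and> set Y \<subseteq> Inl ` \<Gamma> \<union> Inr ` T"
proof (induction rule: gen.induct)
  case (gen_step X Y u v)
  then show ?case
    using letters[of u v] by simp
qed simp

lemma fin_letters: "fin X Y \<Longrightarrow> set X \<subseteq> \<Gamma> \<and> set Y \<subseteq> Inl ` \<Gamma> \<union> Inr ` T"
  unfolding fin_def
proof (elim exE conjE)
  fix X' Y' u v
  assume "gen P X' Y'" "(u, v) \<in> Fin" "X = X' @ u" "Y = v @ Y'"
  then show ?thesis
    using gen_letters[of X' Y'] letters[of u v] by simp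
qed

lemma canc_sound:
  assumes "w \<in> scm_lang canc_scm"
  shows "\<exists>X. fin X (map Inl (rev X) @ map Inr w)"
proof -
  have "(scm_step canc_scm)\<^sup>*\<^sup>* [nS] (map Tm w)"
    using assms by (auto simp: scm_lang_def canc_scm_def)
  moreover have "canc_inv [nS]"
    using canc_inv.growing[OF gen_Nil] by simp
  ultimately have "canc_inv (map Tm w)"
    by (induction) (auto intro: canc_inv_step)
  then show ?thesis
  proof (cases rule: canc_inv.cases)
    case (shrinking X Y x z y)
    \<comment> \<open>No \<open>A\<close> or \<open>C\<close> survives in a terminal word, so the
      whole left code has been cancelled, and unique decoding recovers \<open>Y\<close>.\<close>
    have "set x \<subseteq> {nA, nC}" "set x \<subseteq> range Tm"
      using set_lcode[of X] shrinking by (auto simp: map_eq_append_conv)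
    then have "x = []"
      by (cases x) auto
    then have "rcode Y = rcode (map Inl (rev X) @ map Inr w)"
      using shrinking bar_lcode[of X] by simp
    moreover have "set X \<subseteq> \<Gamma>" "set Y \<subseteq> Inl ` \<Gamma> \<union> Inr ` T"
      using fin_letters shrinking by auto
    ultimately have "Y = map Inl (rev X) @ map Inr w"
      by (intro rcode_inj) auto
    then show ?thesis
      using shrinking by blast
  qed (auto simp: map_eq_append_conv map_eq_Cons_conv)
qed

section \<open>Solutions yield derivations\<close>

lemma canc_stepI:
  "m \<in> free_matrix ` rhss \<union> {mark_AB, mark_CC, erase_DD} \<Longrightarrow> mx_step m s t \<Longrightarrow> (scm_step canc_scm)\<^sup>*\<^sup>* s t"
  by (rule r_into_rtranclp) (auto simp: scm_step_def canc_scm_def)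

lemma free_stepI: "w \<in> rhss \<Longrightarrow> (scm_step canc_scm)\<^sup>*\<^sup>* (p @ nS # q) (p @ w @ q)"
  by (rule canc_stepI[of "free_matrix w"]) (auto simp: mx_step_def matrix_defs)

lemma canc_gen: "gen P X Y \<Longrightarrow> (scm_step canc_scm)\<^sup>*\<^sup>* [nS] (lcode X @ nS # rcode Y)"
proof (induction rule: gen.induct)
  case (gen_step X Y u v)
  then have "lcode u @ nS # rcode v \<in> rhss"
    by (auto simp: rhss_def)
  from free_stepI[OF this, of "lcode X" "rcode Y"] gen_step.IH show ?case
    by (auto intro: rtranclp_trans)
qed simp

lemma cancel_pair:
  assumes "k \<in> {nA, nC}" "nD \<notin> set (x @ y)"
  shows "(scm_step canc_scm)\<^sup>*\<^sup>* (x @ k # flip k # y) (x @ y)"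
proof -
  let ?m = "if k = nA then mark_AB else mark_CC"
  have nosub: "\<not> sublist [nD] (x @ k # flip k # y)"
    using assms set_mono_sublist[of "[nD]" "x @ k # flip k # y"] by (auto simp: flip_def split: if_splits)
  have "apply_rules (mx_rules ?m) (x @ k # flip k # y) (x @ nD # nD # y)"
  proof -
    have "apply_rules [(a, [nD]), (b, [nD])] (x @ Nt a # Nt b # y) (x @ nD # nD # y)" for a b
      unfolding apply_rules.simps
      by (rule exI[of _ x], rule exI[of _ "Nt b # y"], simp, rule exI[of _ "x @ [nD]"]) simp
    then show ?thesis
      using assms(1) by (auto simp: matrix_defs flip_def)
  qed
  then have "mx_step ?m (x @ k # flip k # y) (x @ nD # nD # y)"
    using nosub by (auto simp: mx_step_def matrix_defs)
  then have 1: "(scm_step canc_scm)\<^sup>*\<^sup>* (x @ k # flip k # y) (x @ nD # nD # y)"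
    by (intro canc_stepI[of ?m]) auto
  have "apply_rules [(4, []), (4, [])] (x @ nD # nD # y) (x @ y)"
    unfolding apply_rules.simps
    by (rule exI[of _ x], rule exI[of _ "nD # y"], simp, rule exI[of _ x], rule exI[of _ y], simp)
  then have "mx_step erase_DD (x @ nD # nD # y) (x @ y)"
    by (auto simp: mx_step_def erase_DD_def sublist_def)
  then have "(scm_step canc_scm)\<^sup>*\<^sup>* (x @ nD # nD # y) (x @ y)"
    by (intro canc_stepI[of erase_DD]) auto
  with 1 show ?thesis
    by (rule rtranclp_trans)
qed

text \<open>The last letter of \<open>z\<close> meets its partner at the border first, hence the
  induction from the right end.\<close>

lemma cancel_bar:
  "set z \<subseteq> {nA, nC} \<Longrightarrow> nD \<notin> set y \<Longrightarrow> (scm_step canc_scm)\<^sup>*\<^sup>* (z @ bar z @ y) y"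
proof (induction z arbitrary: y rule: rev_induct)
  case (snoc k z)
  have "nD \<notin> set (z @ bar z @ y)"
    using snoc.prems by (auto simp: bar_def flip_def)
  then have "(scm_step canc_scm)\<^sup>*\<^sup>* (z @ k # flip k # bar z @ y) (z @ bar z @ y)"
    using snoc.prems by (intro cancel_pair) auto
  then show ?case
    using snoc by (auto intro: rtranclp_trans)
qed simp

lemma canc_complete:
  assumes "fin X (map Inl (rev X) @ map Inr w)"
  shows "w \<in> scm_lang canc_scm"
proof -
  let ?Y = "map Inl (rev X) @ map Inr w"
  obtain X' Y' u v where *: "gen P X' Y'" "(u, v) \<in> Fin" "X = X' @ u" "?Y = v @ Y'"
    using assms by (auto simp: fin_def)
  have "lcode u @ rcode v \<in> rhss"
    using * by (auto simp: rhss_def)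
  from free_stepI[OF this, of "lcode X'" "rcode Y'"] canc_gen[OF *(1)]
  have "(scm_step canc_scm)\<^sup>*\<^sup>* [nS] (lcode X @ rcode (v @ Y'))"
    unfolding *(3) by (auto intro: rtranclp_trans)
  then have 1: "(scm_step canc_scm)\<^sup>*\<^sup>* [nS] (lcode X @ rcode ?Y)"
    unfolding *(4) .
  have "(scm_step canc_scm)\<^sup>*\<^sup>* (lcode X @ bar (lcode X) @ map Tm w) (map Tm w)"
    by (rule cancel_bar) (use set_lcode in auto)
  then have "(scm_step canc_scm)\<^sup>*\<^sup>* [nS] (map Tm w)"
    using 1 by (auto simp: bar_lcode)
  moreover have "set w \<subseteq> T"
    using fin_letters[OF assms] by auto
  ultimately show ?thesis
    by (simp add: scm_lang_def canc_scm_def)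
qed

lemma canc_in_SSCM: "{w. \<exists>X. fin X (map Inl (rev X) @ map Inr w)} \<in> SSCM 2 1 5 3 2"
proof -
  have "{w. \<exists>X. fin X (map Inl (rev X) @ map Inr w)} = scm_lang canc_scm"
    using canc_sound canc_complete by blast
  then show ?thesis
    unfolding SSCM_def SCM_def using canc_scm_wf canc_scm_bounds by blast
qed

end

section \<open>Cancellation simulates phrase structure grammars\<close>

text \<open>Pushed letters carry \<open>Star\<close> in front and pulled letters carry it behind, as in the reduction of
  the modified to the ordinary Post correspondence problem. This forces the pair that inserts \<open>Hash\<close>, the
  only one whose pulled word starts with \<open>Star\<close>, to be used exactly once, right after the terminals
  have been written.\<close>

datatype 't letter = Star | Hash | Sy "'t sym"

section \<open>Words interleaved with stars\<close>

definition star_before :: "'t letter list \<Rightarrow> 't letter list" where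
  "star_before cs = concat (map (\<lambda>c. [Star, c]) cs)"

definition star_after :: "'t letter list \<Rightarrow> 't letter list" where
  "star_after cs = concat (map (\<lambda>c. [c, Star]) cs)"

lemma star_before_simps [simp]:
  "star_before [] = []" "star_before (c # cs) = Star # c # star_before cs"
  "star_before (cs @ cs') = star_before cs @ star_before cs'"
  by (simp_all add: star_before_def)

lemma star_after_simps [simp]:
  "star_after [] = []" "star_after (c # cs) = c # Star # star_after cs"
  "star_after (cs @ cs') = star_after cs @ star_after cs'"
  by (simp_all add: star_after_def)

text \<open>Once the pulled word ends in a \<open>Star\<close>, pulling further letters in the form
  \<open>star_after\<close> keeps it in the form \<open>star_before vs @ [Star]\<close>.\<close>

lemma Star_star_after: "Star # star_after cs = star_before cs @ [Star]"
  by (induction cs) auto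

lemma star_before_prefixD:
  assumes "star_before W = star_before vs @ r"
  obtains W' where "W = vs @ W'" "r = star_before W'"
  using assms
proof (induction vs arbitrary: W)
  case (Cons v vs)
  then show ?case
    by (cases W) auto
qed simp

lemma star_before_inj: "star_before W = star_before vs \<Longrightarrow> W = vs"
proof (induction W arbitrary: vs)
  case Nil
  then show ?case
    by (cases vs) auto
next
  case (Cons c W)
  then show ?case
    by (cases vs) auto
qed

lemma star_before_prefix_snoc:
  assumes "star_before W = star_before vs @ [Star] @ r" 
  obtains c W' where "W = vs @ c # W'" "r = c # star_before W'"
proof -
  obtain W' where W': "W = vs @ W'" "[Star] @ r = star_before W'"
    using assms by (rule star_before_prefixD)
  then show ?thesis
    using that by (cases W') auto
qed

locale post_system =
  fixes G :: "'t psg"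
  assumes wf: "psg_wf G"
begin

section \<open>The Post system of a phrase structure grammar\<close>

definition letters :: "'t letter set" where
  "letters = insert Hash (Sy ` syms (ps_N G) (ps_T G))"

text \<open>The rules are reversed because the terminals are pushed in the order opposite to that in which
  they appear in the generated word. The extra letter \<open>c\<close> below keeps the pulled word nonempty
  even for erasing rules, and the empty rule serves to rotate the queue.\<close>

definition rev_rules :: "('t letter list \<times> 't letter list) set" where
  "rev_rules = insert ([], []) ((\<lambda>(u, v). (map Sy (rev u), map Sy (rev v))) ` ps_R G)"

text \<open>The three kinds write an output terminal, close the initial queue with
  \<open>Hash\<close>, and undo a rule by pulling \<open>r\<close> and \<open>c\<close> while
  pushing \<open>l\<close> and \<open>c\<close>. Pulled words are reversed because
  \<open>gen\<close> accumulates them leftwards.\<close>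

definition pairs :: "('t letter list \<times> ('t letter + 't) list) set" where
  "pairs = (\<lambda>a. ([Star, Sy (Tm a)], [Inr a])) ` ps_T G
     \<union> {([Star, Hash], [Inl Star])}
     \<union> (\<lambda>((l, r), c). (star_before (l @ [c]), map Inl (rev (star_after (r @ [c]))))) ` (rev_rules \<times> letters)"

text \<open>The last pull, listed backwards, empties a queue holding the start symbol and
  \<open>Hash\<close>; the \<open>Star\<close> before the start symbol has been pulled
  already.\<close>

definition final_pairs :: "('t letter list \<times> ('t letter + 't) list) set" where
  "final_pairs = {([], map Inl [Hash, Star, Sy (Nt (ps_S G))])}"

lemma pairs_cases:
  assumes "(u, v) \<in> pairs"
  obtains (emit) a where "a \<in> ps_T G" "u = [Star, Sy (Tm a)]" "v = [Inr a]"
  | (init) "u = [Star, Hash]" "v = [Inl Star]"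
  | (rule) l r c where "l = [] \<and> r = [] \<or> (rev l, rev r) \<in> ps_R G" "c = Hash \<or> c \<in> Sy ` syms (ps_N G) (ps_T G)"
      "u = star_before (map Sy l @ [c])" "v = map Inl (rev (star_after (map Sy r @ [c])))"
proof -
  have *: thesis if "((l, r), c) \<in> rev_rules \<times> letters" "u = star_before (l @ [c])"
      "v = map Inl (rev (star_after (r @ [c])))" for l r c
  proof -
    have "(l, r) \<in> rev_rules" "c \<in> letters"
      using that(1) by auto
    then have "\<exists>l' r'. l = map Sy l' \<and> r = map Sy r' \<and> (l' = [] \<and> r' = [] \<or> (rev l', rev r') \<in> ps_R G)"
      unfolding rev_rules_def
    proof (elim insertE imageE)
      fix uv assume "(l, r) = (case uv of (u, v) \<Rightarrow> (map Sy (rev u), map Sy (rev v)))" "uv \<in> ps_R G"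
      then show ?thesis
        by (intro exI[of _ "rev (fst uv)"] exI[of _ "rev (snd uv)"]) (simp add: case_prod_beta)
    qed simp
    then obtain l' r' where "l = map Sy l'" "r = map Sy r'" "l' = [] \<and> r' = [] \<or> (rev l', rev r') \<in> ps_R G"
      by (elim exE conjE)
    with that \<open>c \<in> letters\<close> show thesis
      by (intro rule[of l' r' c]) (simp_all add: letters_def)
  qed
  show thesis
    using assms unfolding pairs_def
    apply (elim UnE imageE)
    subgoal using emit by auto
    subgoal using init by auto
    subgoal for x by (rule *[of "fst (fst x)" "snd (fst x)" "snd x"]) (simp_all add: case_prod_beta)
    done
qed

section \<open>Soundness of the Post system\<close>

abbreviation derives :: "'t sym list \<Rightarrow> 't list \<Rightarrow> bool" where
  "derives s w \<equiv> (psg_step G)\<^sup>*\<^sup>* s (map Tm w)"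

lemma derives_rev_rule:
  assumes "l = [] \<and> r = [] \<or> (rev l, rev r) \<in> ps_R G" "derives (rev (p @ r @ q)) w"
  shows "derives (rev (p @ l @ q)) w"
proof (cases "(rev l, rev r) \<in> ps_R G")
  case True
  then have "psg_step G (rev q @ rev l @ rev p) (rev q @ rev r @ rev p)"
    unfolding psg_step_def by blast
  then show ?thesis
    using assms(2) by (auto intro: converse_rtranclp_into_rtranclp)
qed (use assms in auto)

text \<open>\<open>W\<close> stands for the completed solution, of which the pushed word
  \<open>X\<close> and the pulled word \<open>V\<close> are prefixes. Either only terminals have
  been written, or the queue holds \<beta>, \<open>Hash\<close>, \<alpha> and represents a
  sentential form, reversed, that derives \<open>w\<close>.\<close>

lemma gen_pairs_inv:
  assumes "gen pairs X Y" "Y = map Inl (rev V) @ map Inr w"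
    "star_before W = X @ X'" "star_before W = V @ V'" "Star \<notin> set W"
  shows "V = [] \<and> X = star_before (map (\<lambda>a. Sy (Tm a)) (rev w)) \<or>
    (\<exists>vs \<beta> \<alpha>. V = star_before vs @ [Star] \<and> X = star_before (vs @ map Sy \<beta> @ [Hash] @ map Sy \<alpha>)
       \<and> derives (rev (\<alpha> @ \<beta>)) w)"
  using assms
proof (induction arbitrary: V w X' V' rule: gen.induct)
  case gen_Nil
  then show ?case by simp
next
  case (gen_step X Y u v)
  from gen_step.hyps(2) show ?case
  proof (cases rule: pairs_cases)
    case (emit a)
    \<comment> \<open>The right word begins with an \<open>Inr\<close>, so nothing has been pulled
      yet.\<close>
    then obtain w' where w': "V = []" "w = a # w'" "Y = map Inl (rev []) @ map Inr w'"
      using gen_step.prems(1) by (cases "rev V"; cases w) auto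
    have "X = star_before (map (\<lambda>a. Sy (Tm a)) (rev w'))"
      using gen_step.IH[OF w'(3), of "u @ X'" "star_before W"] gen_step.prems by auto
    then show ?thesis
      using w' emit by auto
  next
    case init
    then obtain V1 where V1: "V = V1 @ [Star]" "Y = map Inl (rev V1) @ map Inr w"
      using gen_step.prems(1) by (cases V rule: rev_cases; cases w) auto
    have "V1 = [] \<and> X = star_before (map (\<lambda>a. Sy (Tm a)) (rev w)) \<or>
      (\<exists>vs \<beta> \<alpha>. V1 = star_before vs @ [Star] \<and> X = star_before (vs @ map Sy \<beta> @ [Hash] @ map Sy \<alpha>)
       \<and> derives (rev (\<alpha> @ \<beta>)) w)"
      using gen_step.IH[OF V1(2), of "u @ X'" "[Star] @ V'"] gen_step.prems V1(1) by auto
    then show ?thesis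
    proof (elim disjE exE conjE)
      assume "V1 = []" "X = star_before (map (\<lambda>a. Sy (Tm a)) (rev w))"
      then show ?thesis
        using V1 init
        by - (rule disjI2, rule exI[of _ "[]"], rule exI[of _ "map Tm (rev w)"], rule exI[of _ "[]"],
            simp add: rev_map comp_def)
    next
      \<comment> \<open>A second use of this pair would pull two stars in a row and make
        \<open>Star\<close> a letter of \<open>W\<close>.\<close>
      fix vs assume "V1 = star_before vs @ [Star]"
      then have "star_before W = star_before vs @ [Star] @ Star # V'"
        using gen_step.prems(3) V1 by simp
      then obtain c W' where "W = vs @ c # W'" "Star # V' = c # star_before W'"
        by (rule star_before_prefix_snoc)
      then show ?thesis
        using gen_step.prems(4) by auto
    qed
  next
    case (rule l r c)
    let ?V2 = "star_after (map Sy r @ [c])"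
    have c: "c \<noteq> Star"
      using rule(2) by auto
    obtain V1 where V1: "V = V1 @ ?V2" "Y = map Inl (rev V1) @ map Inr w"
    proof -
      have eq: "map Inl (rev ?V2) @ Y = map Inl (rev V) @ map Inr w"
        using gen_step.prems(1) rule(4) by simp
      \<comment> \<open>The maximal prefix of \<open>Inl\<close> letters separates the pulled
        letters from the output on both sides of \<open>eq\<close>.\<close>
      have "takeWhile isl (map Inl (rev ?V2) @ Y) = map Inl (rev ?V2) @ takeWhile isl Y"
        by (intro takeWhile_append2) auto
      moreover have "takeWhile isl (map Inl (rev V) @ map Inr w) = map Inl (rev V)"
        by (subst takeWhile_append2) (auto simp: takeWhile_eq_Nil_iff hd_map)
      ultimately have "map Inl (rev V) = map Inl (rev ?V2) @ takeWhile isl Y"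
        using eq by metis
      then obtain A U where "rev V = A @ U" "map Inl A = (map Inl (rev ?V2) :: ('t letter + 't) list)"
        by (auto simp del: star_after_simps simp: map_eq_append_conv)
      then have U: "rev V = rev ?V2 @ U"
        by (simp only: inj_map_eq_map[OF inj_Inl])
      then have "V = rev U @ ?V2"
        by (metis rev_append rev_rev_ident)
      moreover have "Y = map Inl U @ map Inr w"
        using eq unfolding U map_append append_assoc same_append_eq .
      ultimately show thesis
        using that[of "rev U"] by simp
    qed
    have "V1 = [] \<and> X = star_before (map (\<lambda>a. Sy (Tm a)) (rev w)) \<or>
      (\<exists>vs \<beta> \<alpha>. V1 = star_before vs @ [Star] \<and> X = star_before (vs @ map Sy \<beta> @ [Hash] @ map Sy \<alpha>)
       \<and> derives (rev (\<alpha> @ \<beta>)) w)"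
      using gen_step.IH[OF V1(2), of "u @ X'" "?V2 @ V'"] gen_step.prems V1(1) by auto
    then show ?thesis
    proof (elim disjE exE conjE)
      assume "V1 = []"
      then have "star_before W = ?V2 @ V'"
        using V1 gen_step.prems by simp
      \<comment> \<open>A nonempty starred word begins with \<open>Star\<close>, whereas
        \<open>?V2\<close> begins with a letter of \<open>r\<close> or with
        \<open>c\<close>.\<close>
      then have False
        using c by (cases W; cases r) auto
      then show ?thesis ..
    next
      fix vs \<beta> \<alpha>
      assume *: "V1 = star_before vs @ [Star]" "X = star_before (vs @ map Sy \<beta> @ [Hash] @ map Sy \<alpha>)"
        "derives (rev (\<alpha> @ \<beta>)) w"
      have V: "V = star_before (vs @ map Sy r @ [c]) @ [Star]"
        using V1(1) *(1) Star_star_after[of "map Sy r @ [c]"] by simp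
      obtain W1 where W1: "W = vs @ map Sy r @ [c] @ W1"
        using gen_step.prems(3) V star_before_prefixD[of W "vs @ map Sy r @ [c]" "[Star] @ V'"] by auto
      have X: "X @ u = star_before (vs @ map Sy \<beta> @ [Hash] @ map Sy \<alpha> @ map Sy l @ [c])"
        using *(2) rule(3) by simp
      obtain W2 where W2: "W = vs @ map Sy \<beta> @ [Hash] @ map Sy \<alpha> @ map Sy l @ [c] @ W2"
        using gen_step.prems(2) X
          star_before_prefixD[of W "vs @ map Sy \<beta> @ [Hash] @ map Sy \<alpha> @ map Sy l @ [c]" X'] by auto
      have eq: "map Sy r @ c # W1 = map Sy \<beta> @ Hash # map Sy \<alpha> @ map Sy l @ c # W2"
        using W1 W2 by simp
      have inj: "map Sy a = map Sy b \<longleftrightarrow> a = b" for a b :: "'t sym list"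
        by (rule inj_map_eq_map) (simp add: inj_def)
      show ?thesis
      \<comment> \<open>If \<open>c\<close> is \<open>Hash\<close>, the pull uses up all of \<beta>,
        and the queue becomes \<alpha>, \<open>l\<close>, \<open>Hash\<close>. Otherwise
        \<open>r\<close> and \<open>c\<close> form a prefix of \<beta>, and \<open>l\<close> and
        \<open>c\<close> are appended to \<alpha>.\<close>
      proof (cases "c = Hash")
        case True
        have "takeWhile (\<lambda>d. d \<noteq> Hash) (map Sy a @ Hash # b) = map Sy a" for a :: "'t sym list" and b
          by (induction a) auto
        with eq True have "r = \<beta>"
          using inj by metis
        then have "derives (rev (\<alpha> @ l)) w"
          using derives_rev_rule[of l r \<alpha> "[]" w] *(3) rule(1) by simp
        then show ?thesis
          using V X True \<open>r = \<beta>\<close>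
          by - (rule disjI2, rule exI[of _ "vs @ map Sy r @ [c]"], rule exI[of _ "\<alpha> @ l"], rule exI[of _ "[]"], simp)
      next
        case False
        then obtain d where d: "c = Sy d"
          using rule(2) by auto
        from eq False obtain m where m: "map Sy \<beta> = map Sy r @ c # m"
          by (rule append_Cons_eq_split[of "map Sy r" c]) (auto simp: map_eq_append_conv map_eq_Cons_conv)
        then obtain \<beta>' where \<beta>: "\<beta> = r @ d # \<beta>'"
          using d inj by (auto simp: map_eq_append_conv map_eq_Cons_conv)
        have "derives (rev ((\<alpha> @ l @ [d]) @ \<beta>')) w"
          using derives_rev_rule[of l r \<alpha> "d # \<beta>'" w] *(3) rule(1) \<beta> by simp
        then show ?thesis
          using V X d \<beta>
          by - (rule disjI2, rule exI[of _ "vs @ map Sy r @ [c]"], rule exI[of _ \<beta>'], rule exI[of _ "\<alpha> @ l @ [d]"], simp)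
      qed
    qed
  qed
qed

text \<open>In a completed solution the pushed word itself serves as the starred word of
  \<open>W\<close> in \<open>gen_pairs_inv\<close>.\<close>

lemma gen_pairs_X: "gen pairs X Y \<Longrightarrow> \<exists>us. X = star_before us \<and> Star \<notin> set us"
proof (induction rule: gen.induct)
  case gen_Nil
  then show ?case
    by (intro exI[of _ "[]"]) simp
next
  case (gen_step X Y u v)
  then obtain us where us: "X = star_before us" "Star \<notin> set us"
    by blast
  have "\<exists>us'. u = star_before us' \<and> Star \<notin> set us'"
    using gen_step.hyps(2)
  proof (cases rule: pairs_cases)
    case (emit a)
    then show ?thesis
      by (intro exI[of _ "[Sy (Tm a)]"]) simp
  next
    case init
    then show ?thesis
      by (intro exI[of _ "[Hash]"]) simp
  next
    case (rule l r c)
    then show ?thesis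
      by (intro exI[of _ "map Sy l @ [c]"]) auto
  qed
  then obtain us' where "u = star_before us'" "Star \<notin> set us'"
    by blast
  with us show ?case
    by (intro exI[of _ "us @ us'"]) simp
qed

lemma pairs_sound:
  assumes "gen pairs X Y" "map Inl [Hash, Star, Sy (Nt (ps_S G))] @ Y = map Inl (rev X) @ map Inr w"
  shows "derives [Nt (ps_S G)] w"
proof -
  obtain us where us: "X = star_before us" "Star \<notin> set us"
    using gen_pairs_X[OF assms(1)] by blast
  obtain V where V: "X = V @ [Sy (Nt (ps_S G)), Star, Hash]" "Y = map Inl (rev V) @ map Inr w"
  proof -
    obtain us1 c where us1: "us = us1 @ [c]"
      using assms(2) us by (cases us rule: rev_cases; cases w) auto
    obtain us2 d where us2: "us1 = us2 @ [d]"
      using assms(2) us us1 by (cases us1 rule: rev_cases; cases w) auto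
    show thesis
      using assms(2) us us1 us2 by (intro that[of "star_before us2 @ [Star]"]) auto
  qed
  have "star_before us = X @ []" "star_before us = V @ [Sy (Nt (ps_S G)), Star, Hash]"
    using us V by simp_all
  from gen_pairs_inv[OF assms(1) V(2) this us(2)] show ?thesis
  proof (elim disjE exE conjE)
    assume "V = []"
    then show ?thesis
      using V us by (cases us) auto
  next
    fix vs \<beta> \<alpha>
    assume *: "V = star_before vs @ [Star]" "X = star_before (vs @ map Sy \<beta> @ [Hash] @ map Sy \<alpha>)"
      "derives (rev (\<alpha> @ \<beta>)) w"
    have "star_before (vs @ map Sy \<beta> @ [Hash] @ map Sy \<alpha>) = star_before (vs @ [Sy (Nt (ps_S G)), Hash])"
      using V(1) *(1,2) by simp
    then have "map Sy \<beta> @ Hash # map Sy \<alpha> = [Sy (Nt (ps_S G)), Hash]"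
      using star_before_inj by (metis append_Cons append_Nil same_append_eq)
    then have "\<beta> = [Nt (ps_S G)] \<and> \<alpha> = []"
      by (cases \<beta>; cases "tl \<beta>") auto
    then show ?thesis
      using *(3) by simp
  qed
qed

section \<open>Completeness of the Post system\<close>

text \<open>\<open>q\<close> is the current queue: what has been pushed, without the letters
  \<open>vs\<close> already pulled. The pulled word is one \<open>Star\<close> ahead.\<close>

definition pending :: "'t list \<Rightarrow> 't letter list \<Rightarrow> bool" where
  "pending w q \<longleftrightarrow> (\<exists>vs. gen pairs (star_before (vs @ q)) (map Inl (rev (star_before vs @ [Star])) @ map Inr w))"

lemma pending_rule:
  assumes "pending w (r @ c # q)" "(l, r) \<in> rev_rules" "c \<in> letters"
  shows "pending w (q @ l @ [c])"
proof -
  obtain vs where vs: "gen pairs (star_before (vs @ r @ c # q)) (map Inl (rev (star_before vs @ [Star])) @ map Inr w)"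
    using assms(1) by (auto simp: pending_def)
  have "(star_before (l @ [c]), map Inl (rev (star_after (r @ [c])))) \<in> pairs"
    unfolding pairs_def using assms(2,3) by (intro UnI2 rev_image_eqI[of "((l, r), c)"]) auto
  from gen_step[OF vs this]
  have "gen pairs (star_before ((vs @ r @ [c]) @ q @ l @ [c]))
    (map Inl (rev (star_after (r @ [c]))) @ map Inl (rev (star_before vs @ [Star])) @ map Inr w)"
    by simp
  also have "map Inl (rev (star_after (r @ [c]))) @ map Inl (rev (star_before vs @ [Star])) @ map Inr w =
    map Inl (rev (star_before vs @ Star # star_after (r @ [c]))) @ map Inr w"
    by simp
  also have "star_before vs @ Star # star_after (r @ [c]) = star_before (vs @ r @ [c]) @ [Star]"
    unfolding Star_star_after by simp
  finally show ?thesis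
    unfolding pending_def by blast
qed

text \<open>With the empty rule, a pair pulls and pushes the same letter, which moves it from the
  front to the back.\<close>

lemma pending_rotate:
  assumes "pending w (xs @ ys)" "set xs \<subseteq> letters"
  shows "pending w (ys @ xs)"
  using assms
proof (induction xs arbitrary: ys)
  case (Cons x xs)
  then have "pending w (xs @ (ys @ [x]))"
    using pending_rule[of w "[]" x "xs @ ys" "[]"] by (simp add: rev_rules_def)
  from Cons.IH[OF this] Cons.prems show ?case
    by simp
qed simp

lemma pending_init:
  assumes "set w \<subseteq> ps_T G"
  shows "pending w (map Sy (rev (map Tm w)) @ [Hash])"
proof -
  have "gen pairs (star_before (map Sy (rev (map Tm w)))) (map Inr w)"
    using assms
  proof (induction w)
    case Nil
    then show ?case
      by (simp add: gen_Nil)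
  next
    case (Cons a w)
    have "([Star, Sy (Tm a)], [Inr a]) \<in> pairs"
      using Cons.prems by (simp add: pairs_def)
    from gen_step[OF Cons.IH this] Cons.prems show ?case
      by simp
  qed
  moreover have "([Star, Hash], [Inl Star]) \<in> pairs"
    by (simp add: pairs_def)
  ultimately have "gen pairs (star_before (map Sy (rev (map Tm w))) @ [Star, Hash]) ([Inl Star] @ map Inr w)"
    by (rule gen_step)
  then show ?thesis
    unfolding pending_def by (intro exI[of _ "[]"]) simp
qed

text \<open>The queue is accessible only at its ends, so \<open>rev q\<close> is first rotated to
  the back, then \<open>rev v\<close> is exchanged for \<open>rev u\<close>, and the remaining
  letters are rotated behind it to restore the order.\<close>

lemma pending_step:
  assumes "psg_step G s s'" "pending w (map Sy (rev s') @ [Hash])" "set s' \<subseteq> syms (ps_N G) (ps_T G)"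
  shows "pending w (map Sy (rev s) @ [Hash])"
proof -
  obtain p q u v where uv: "(u, v) \<in> ps_R G" "s = p @ u @ q" "s' = p @ v @ q"
    using assms(1) by (auto simp: psg_step_def)
  have sub: "set (map Sy (rev q)) \<subseteq> letters" "set (map Sy (rev p) @ [Hash]) \<subseteq> letters"
    using assms(3) uv by (auto simp: letters_def)
  have R: "(map Sy (rev u), map Sy (rev v)) \<in> rev_rules"
    using uv(1) unfolding rev_rules_def by (intro insertI2 rev_image_eqI[of "(u, v)"]) auto
  \<comment> \<open>The trailing \<open>Hash\<close> guarantees a letter behind \<open>rev v\<close>
    to serve as the extra letter of the pair.\<close>
  obtain c t where ct: "map Sy (rev p) @ [Hash] = c # t"
    by (cases "map Sy (rev p) @ [Hash]") auto
  then have c: "c \<in> letters" "set t \<subseteq> letters"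
    using sub by auto
  have "pending w (map Sy (rev q) @ map Sy (rev v) @ map Sy (rev p) @ [Hash])"
    using assms(2) uv(3) by simp
  then have "pending w (map Sy (rev q) @ map Sy (rev v) @ c # t)"
    unfolding ct .
  from pending_rotate[OF this sub(1)]
  have "pending w (map Sy (rev v) @ c # (t @ map Sy (rev q)))"
    by simp
  from pending_rule[OF this R c(1)]
  have "pending w (t @ map Sy (rev q) @ map Sy (rev u) @ [c])"
    by simp
  from pending_rotate[OF this c(2)]
  have "pending w (map Sy (rev q) @ map Sy (rev u) @ c # t)"
    by simp
  then show ?thesis
    unfolding ct[symmetric] uv(2) by simp
qed

lemma psg_step_symbols:
  assumes "psg_step G s s'" "set s \<subseteq> syms (ps_N G) (ps_T G)"
  shows "set s' \<subseteq> syms (ps_N G) (ps_T G)"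
proof -
  obtain p q u v where uv: "(u, v) \<in> ps_R G" "s = p @ u @ q" "s' = p @ v @ q"
    using assms(1) by (auto simp: psg_step_def)
  have "set v \<subseteq> syms (ps_N G) (ps_T G)"
    using wf uv(1) unfolding psg_wf_def by fast
  then show ?thesis
    using uv assms(2) by simp
qed

text \<open>The queue starts with the terminal word and runs the derivation backwards, hence the
  induction from its end.\<close>

lemma pending_derives:
  assumes "derives s w" "set s \<subseteq> syms (ps_N G) (ps_T G)" "set w \<subseteq> ps_T G"
  shows "pending w (map Sy (rev s) @ [Hash])"
  using assms(1,2)
proof (induction rule: converse_rtranclp_induct)
  case base
  then show ?case
    using pending_init[OF assms(3)] by simp
next
  case (step s s')
  then show ?case
    using psg_step_symbols pending_step by blast
qed

section \<open>Solutions of the Post system and the inclusion of \<open>RE\<close>\<close>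

lemma psg_lang_eq:
  "w \<in> psg_lang G \<longleftrightarrow> (\<exists>X Y. gen pairs X Y \<and>
     map Inl [Hash, Star, Sy (Nt (ps_S G))] @ Y = map Inl (rev X) @ map Inr w \<and> set w \<subseteq> ps_T G)"
  (is "_ \<longleftrightarrow> ?rhs")
proof
  assume "w \<in> psg_lang G"
  then have w: "derives [Nt (ps_S G)] w" "set w \<subseteq> ps_T G"
    by (auto simp: psg_lang_def)
  have "pending w ([Sy (Nt (ps_S G)), Hash])"
    using pending_derives[OF w(1) _ w(2)] wf by (simp add: psg_wf_def syms_def)
  then obtain vs where "gen pairs (star_before (vs @ [Sy (Nt (ps_S G)), Hash]))
      (map Inl (rev (star_before vs @ [Star])) @ map Inr w)"
    unfolding pending_def by blast
  then show ?rhs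
    using w(2) by (intro exI conjI) auto
next
  assume ?rhs
  then show "w \<in> psg_lang G"
    using pairs_sound by (auto simp: psg_lang_def)
qed

lemma psg_lang_in_SSCM: "psg_lang G \<in> SSCM 2 1 5 3 2"
proof -
  let ?\<Gamma> = "insert Star letters"
  have fin: "finite letters" "finite rev_rules"
    using wf by (auto simp: letters_def rev_rules_def psg_wf_def syms_def)
  then obtain code :: "'t letter \<Rightarrow> nat" where code: "inj_on code ?\<Gamma>"
    using finite_imp_inj_to_nat_seg[of ?\<Gamma>] by blast
  have T: "finite (ps_T G)"
    using wf by (simp add: psg_wf_def)
  have rr: "set l \<subseteq> letters \<and> set r \<subseteq> letters" if lr: "(l, r) \<in> rev_rules" for l r
  proof -
    consider "l = []" "r = []" | u v where "(u, v) \<in> ps_R G" "l = map Sy (rev u)" "r = map Sy (rev v)"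
      using lr by (auto simp: rev_rules_def)
    then show ?thesis
    proof cases
      case (2 u v)
      have "set u \<subseteq> syms (ps_N G) (ps_T G)" "set v \<subseteq> syms (ps_N G) (ps_T G)"
        using wf 2(1) unfolding psg_wf_def by fast+
      then show ?thesis
        using 2 by (auto simp: letters_def)
    qed simp
  qed
  have st: "set (star_before cs) \<subseteq> insert Star (set cs)" "set (star_after cs) \<subseteq> insert Star (set cs)" for cs :: "'t letter list"
    by (auto simp: star_before_def star_after_def)
  have sets: "set u \<subseteq> ?\<Gamma> \<and> set v \<subseteq> Inl ` ?\<Gamma> \<union> Inr ` ps_T G" if uv: "(u, v) \<in> pairs \<union> final_pairs" for u v
  proof -
    consider a where "a \<in> ps_T G" "u = [Star, Sy (Tm a)]" "v = [Inr a]"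
      | "u = [Star, Hash]" "v = [Inl Star]"
      | l r c where "(l, r) \<in> rev_rules" "c \<in> letters" "u = star_before (l @ [c])" "v = map Inl (rev (star_after (r @ [c])))"
      | "u = []" "v = map Inl [Hash, Star, Sy (Nt (ps_S G))]"
      using uv by (auto simp: pairs_def final_pairs_def simp del: star_before_simps star_after_simps)
    then show ?thesis
    proof cases
      case (3 l r c)
      have "set u \<subseteq> ?\<Gamma>"
        using st(1)[of "l @ [c]"] rr[OF 3(1)] 3 by auto
      moreover have "set (star_after (r @ [c])) \<subseteq> ?\<Gamma>"
        using st(2)[of "r @ [c]"] rr[OF 3(1)] 3 by auto
      then have "set v \<subseteq> Inl ` ?\<Gamma>"
        unfolding 3(4) set_map set_rev by (rule image_mono)
      ultimately show ?thesis
        by blast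
    qed (use wf in \<open>auto simp: letters_def syms_def psg_wf_def\<close>)
  qed
  interpret cancellation "ps_T G" code ?\<Gamma> pairs final_pairs
  proof
    show "finite pairs" "finite final_pairs"
      using fin T by (auto simp: pairs_def final_pairs_def)
    show "([], []) \<notin> pairs \<union> final_pairs"
      by (auto simp: pairs_def final_pairs_def)
  qed (use T code sets in auto)
  have fin_iff: "fin X Z \<longleftrightarrow> (\<exists>Y. gen pairs X Y \<and> Z = map Inl [Hash, Star, Sy (Nt (ps_S G))] @ Y)" for X Z
    unfolding fin_def by (auto simp: final_pairs_def)
  have "psg_lang G = {w. \<exists>X. fin X (map Inl (rev X) @ map Inr w)}"
  proof (intro set_eqI iffI; unfold mem_Collect_eq)
    fix w assume "w \<in> psg_lang G"
    then show "\<exists>X. fin X (map Inl (rev X) @ map Inr w)"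
      unfolding psg_lang_eq fin_iff by metis
  next
    fix w assume "\<exists>X. fin X (map Inl (rev X) @ map Inr w)"
    then obtain X where X: "fin X (map Inl (rev X) @ map Inr w)"
      by blast
    then obtain Y where "gen pairs X Y" "map Inl (rev X) @ map Inr w = map Inl [Hash, Star, Sy (Nt (ps_S G))] @ Y"
      unfolding fin_iff by blast
    moreover have "set w \<subseteq> ps_T G"
      using fin_letters[OF X] by auto
    ultimately show "w \<in> psg_lang G"
      unfolding psg_lang_eq by metis
  qed
  then show ?thesis
    using canc_in_SSCM by simp
qed

end

theorem mainTheorem1:
  "(SSCM 2 1 5 3 2 :: 't list set set) = RE"
proof
  show "(SSCM 2 1 5 3 2 :: 't list set set) \<subseteq> RE"
    unfolding SSCM_def SCM_def using scm_lang_in_RE by blast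
  show "RE \<subseteq> (SSCM 2 1 5 3 2 :: 't list set set)"
    unfolding RE_def using post_system.psg_lang_in_SSCM post_system.intro by blast
qed

end
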